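(* Let $\Omega\subseteq\mathbb{R}^N$ be a domain, let $s\in(0,1)$, and let $A$ be a bounded (measurable) vector field, with values in $\mathbb{R}^N$, on the convex hull of $\Omega$. Then the regional magnetic fractional Laplacian $(-\Delta_{2,A})^s$ is a self-adjoint operator on $L^2(\Omega,\mathbb{C})$.
   Context: A domain is a connected open set. For an open set $\Omega\subseteq\mathbb{R}^N$, $s\in(0,1)$ and a vector field $A$ on the convex hull of $\Omega$, set $$[f]_{W^{s,2}_A(\Omega,\mathbb{C})}^2:=\iint_{\Omega\times\Omega}\frac{\left|f(x)-e^{i(x-y)\cdot A\left(\frac{x+y}{2}\right)}f(y)\right|^2}{|x-y|^{N+2s}}\,dx\,dy;$$ $W^{s,2}(\Omega,\mathbb{C})$ is the space of $f\in L^2(\Omega,\mathbb{C})$ for which this quantity with $A\equiv0$ is finite (for bounded $A$ it coincides with the space where the quantity with $A$ is finite). The regional magnetic fractional Laplacian $(-\Delta_{2,A})^s$ is given by the formula $$(-\Delta_{2,A})^sf(x)=\mathrm{p.v.}\int_\Omega\frac{f(x)-e^{i(x-y)\cdot A\left(\frac{x+y}{2}\right)}f(y)}{|x-y|^{N+2s}}\,dy,$$ understood (up to a positive constant normalization factor) as the operator associated with the quadratic form $[\cdot]^2_{W^{s,2}_A(\Omega,\mathbb{C})}$ on $W^{s,2}(\Omega,\mathbb{C})$. That is, with $$a(f,g):=\iint_{\Omega\times\Omega}\frac{\left(f(x)-e^{i(x-y)\cdot A\left(\frac{x+y}{2}\right)}f(y)\right)\overline{\left(g(x)-e^{i(x-y)\cdot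 A\left(\frac{x+y}{2}\right)}g(y)\right)}}{|x-y|^{N+2s}}\,dx\,dy,$$ its domain consists of those $f\in W^{s,2}(\Omega,\mathbb{C})$ for which there is $h\in L^2(\Omega,\mathbb{C})$ with $a(f,g)=\int_\Omega h\overline g$ for all $g\in W^{s,2}(\Omega,\mathbb{C})$, and the operator sends $f$ to $h$. *)

theory Defs
  imports "HOL-Analysis.Analysis"
begin

section \<open>The complex Hilbert space of square-integrable functions\<close>

definition L2_fun :: "'a measure \<Rightarrow> ('a \<Rightarrow> complex) set" where
  "L2_fun M = {f \<in> borel_measurable M. integrable M (\<lambda>x. (cmod (f x))\<^sup>2)}"

definition L2_class :: "'a measure \<Rightarrow> ('a \<Rightarrow> complex) \<Rightarrow> ('a \<Rightarrow> complex) set" where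
  "L2_class M f = {g \<in> L2_fun M. AE x in M. g x = f x}"

text \<open>Elements of \<open>L2 M\<close> are almost-everywhere equivalence classes, represented as sets of functions.\<close>

definition L2 :: "'a measure \<Rightarrow> ('a \<Rightarrow> complex) set set" where
  "L2 M = L2_class M ` L2_fun M"

definition L2_rep :: "('a \<Rightarrow> complex) set \<Rightarrow> 'a \<Rightarrow> complex" where
  "L2_rep F = (SOME f. f \<in> F)"

definition L2_lincomb :: "'a measure \<Rightarrow> complex \<Rightarrow> ('a \<Rightarrow> complex) set \<Rightarrow> complex \<Rightarrow>
    ('a \<Rightarrow> complex) set \<Rightarrow> ('a \<Rightarrow> complex) set" where
  "L2_lincomb M c F d G = L2_class M (\<lambda>x. c * L2_rep F x + d * L2_rep G x)"

definition L2_inner :: "'a measure \<Rightarrow> ('a \<Rightarrow> complex) set \<Rightarrow> ('a \<Rightarrow> complex) set \<Rightarrow> complex" where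
  "L2_inner M F G = (\<integral>x. L2_rep F x * cnj (L2_rep G x) \<partial>M)"

definition L2_norm :: "'a measure \<Rightarrow> ('a \<Rightarrow> complex) set \<Rightarrow> real" where
  "L2_norm M F = sqrt (Re (L2_inner M F F))"

text \<open>The choice of representatives is immaterial.\<close>

lemma L2_rep_class:
  assumes "f \<in> L2_fun M"
  shows "L2_rep (L2_class M f) \<in> L2_fun M" "AE x in M. L2_rep (L2_class M f) x = f x"
proof -
  have "f \<in> L2_class M f"
    using assms by (simp add: L2_class_def)
  then have "L2_rep (L2_class M f) \<in> L2_class M f"
    unfolding L2_rep_def by (rule someI[where P = "\<lambda>u. u \<in> L2_class M f"])
  then show "L2_rep (L2_class M f) \<in> L2_fun M" "AE x in M. L2_rep (L2_class M f) x = f x"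
    by (simp_all add: L2_class_def)
qed

lemma L2_inner_class:
  assumes "f \<in> L2_fun M" "g \<in> L2_fun M"
  shows "L2_inner M (L2_class M f) (L2_class M g) = (\<integral>x. f x * cnj (g x) \<partial>M)"
  unfolding L2_inner_def
proof (rule integral_cong_AE)
  have [measurable]: "f \<in> borel_measurable M" "g \<in> borel_measurable M"
    "L2_rep (L2_class M f) \<in> borel_measurable M" "L2_rep (L2_class M g) \<in> borel_measurable M"
    using assms L2_rep_class(1)[OF assms(1)] L2_rep_class(1)[OF assms(2)]
    by (simp_all add: L2_fun_def)
  have cnj_meas [measurable]: "cnj \<in> borel_measurable borel"
    by (intro borel_measurable_continuous_onI continuous_intros)
  show "(\<lambda>x. L2_rep (L2_class M f) x * cnj (L2_rep (L2_class M g) x)) \<in> borel_measurable M"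
    "(\<lambda>x. f x * cnj (g x)) \<in> borel_measurable M"
    by measurable
  show "AE x in M. L2_rep (L2_class M f) x * cnj (L2_rep (L2_class M g) x) = f x * cnj (g x)"
    using L2_rep_class(2)[OF assms(1)] L2_rep_class(2)[OF assms(2)] by eventually_elim simp
qed

lemma L2_lincomb_class:
  assumes "f \<in> L2_fun M" "g \<in> L2_fun M"
  shows "L2_lincomb M c (L2_class M f) d (L2_class M g) = L2_class M (\<lambda>x. c * f x + d * g x)"
proof -
  have eq: "AE x in M. c * L2_rep (L2_class M f) x + d * L2_rep (L2_class M g) x = c * f x + d * g x"
    using L2_rep_class(2)[OF assms(1)] L2_rep_class(2)[OF assms(2)] by eventually_elim simp
  have "(AE x in M. u x = c * L2_rep (L2_class M f) x + d * L2_rep (L2_class M g) x) \<longleftrightarrow>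
      (AE x in M. u x = c * f x + d * g x)" for u
    by (rule eventually_subst) (use eq in eventually_elim, simp)
  then show ?thesis
    by (simp add: L2_lincomb_def L2_class_def)
qed

section \<open>Unbounded operators, given by their graphs\<close>

definition L2_operator :: "'a measure \<Rightarrow> (('a \<Rightarrow> complex) set \<times> ('a \<Rightarrow> complex) set) set \<Rightarrow> bool" where
  "L2_operator M T \<longleftrightarrow>
     T \<subseteq> L2 M \<times> L2 M \<and> T \<noteq> {} \<and> single_valued T \<and>
     (\<forall>(F, H) \<in> T. \<forall>(F', H') \<in> T. \<forall>c d. (L2_lincomb M c F d F', L2_lincomb M c H d H') \<in> T)"

definition L2_dense :: "'a measure \<Rightarrow> ('a \<Rightarrow> complex) set set \<Rightarrow> bool" where
  "L2_dense M D \<longleftrightarrow> (\<forall>F \<in> L2 M. \<forall>e > 0. \<exists>G \<in> D. L2_norm M (L2_lincomb M 1 F (-1) G) < e)"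

definition L2_adjoint :: "'a measure \<Rightarrow> (('a \<Rightarrow> complex) set \<times> ('a \<Rightarrow> complex) set) set \<Rightarrow>
    (('a \<Rightarrow> complex) set \<times> ('a \<Rightarrow> complex) set) set" where
  "L2_adjoint M T = {(F, H). F \<in> L2 M \<and> H \<in> L2 M \<and>
     (\<forall>(U, V) \<in> T. L2_inner M V F = L2_inner M U H)}"

text \<open>Equality of the graphs of an operator and its adjoint includes equality of their domains.\<close>

definition L2_self_adjoint :: "'a measure \<Rightarrow> (('a \<Rightarrow> complex) set \<times> ('a \<Rightarrow> complex) set) set \<Rightarrow> bool" where
  "L2_self_adjoint M T \<longleftrightarrow> L2_operator M T \<and> L2_dense M (Domain T) \<and> L2_adjoint M T = T"

section \<open>The regional magnetic fractional Laplacian\<close>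

definition magnetic_diff :: "('a::euclidean_space \<Rightarrow> 'a) \<Rightarrow> ('a \<Rightarrow> complex) \<Rightarrow> 'a \<Rightarrow> 'a \<Rightarrow> complex" where
  "magnetic_diff A f x y =
     f x - exp (\<i> * complex_of_real ((x - y) \<bullet> A ((x + y) /\<^sub>R 2))) * f y"

text \<open>On the diagonal both integrands below are \<open>0\<close>, as division by \<open>0\<close> yields \<open>0\<close>; the diagonal
  is a null set.\<close>

definition magnetic_seminorm_sq ::
    "real \<Rightarrow> ('a::euclidean_space \<Rightarrow> 'a) \<Rightarrow> 'a set \<Rightarrow> ('a \<Rightarrow> complex) \<Rightarrow> ennreal" where
  "magnetic_seminorm_sq s A \<Omega> f =
     (\<integral>\<^sup>+ (x, y). ennreal ((cmod (magnetic_diff A f x y))\<^sup>2 / norm (x - y) powr (real DIM('a) + 2 * s))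
        \<partial>lebesgue_on (\<Omega> \<times> \<Omega>))"

definition frac_sobolev :: "real \<Rightarrow> 'a::euclidean_space set \<Rightarrow> ('a \<Rightarrow> complex) set" where
  "frac_sobolev s \<Omega> =
     {f \<in> L2_fun (lebesgue_on \<Omega>). magnetic_seminorm_sq s (\<lambda>_. 0) \<Omega> f < \<infinity>}"

definition magnetic_form ::
    "real \<Rightarrow> ('a::euclidean_space \<Rightarrow> 'a) \<Rightarrow> 'a set \<Rightarrow> ('a \<Rightarrow> complex) \<Rightarrow> ('a \<Rightarrow> complex) \<Rightarrow> complex" where
  "magnetic_form s A \<Omega> f g =
     (\<integral> (x, y). magnetic_diff A f x y * cnj (magnetic_diff A g x y)
          / complex_of_real (norm (x - y) powr (real DIM('a) + 2 * s))
        \<partial>lebesgue_on (\<Omega> \<times> \<Omega>))"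

text \<open>The graph of the operator associated with the form, with normalization constant \<open>1\<close>.\<close>

definition magnetic_frac_laplacian :: "real \<Rightarrow> ('a::euclidean_space \<Rightarrow> 'a) \<Rightarrow> 'a set \<Rightarrow>
    (('a \<Rightarrow> complex) set \<times> ('a \<Rightarrow> complex) set) set" where
  "magnetic_frac_laplacian s A \<Omega> =
     {(L2_class (lebesgue_on \<Omega>) f, L2_class (lebesgue_on \<Omega>) h) | f h.
        f \<in> frac_sobolev s \<Omega> \<and> h \<in> L2_fun (lebesgue_on \<Omega>) \<and>
        (\<forall>g \<in> frac_sobolev s \<Omega>.
           magnetic_form s A \<Omega> f g = (\<integral>x. h x * cnj (g x) \<partial>lebesgue_on \<Omega>))}"

end

theory Submission
  imports Defs
begin

text \<open>
  Write \<open>D f (x, y) = (f x - e\<^sup>i\<^sup>\<theta> f y) / |x - y|\<^bsup>(N + 2s)/2\<^esup>\<close> with the magnetic phase \<open>\<theta>\<close>.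
  Then \<open>a(f, g) = \<langle>D f, D g\<rangle>\<close>, so that the operator is \<open>D\<^sup>* D\<close>, and by von Neumann's theorem this is
  self-adjoint as soon as \<open>D\<close>, as an operator from \<open>L\<^sup>2(\<Omega>)\<close> to \<open>L\<^sup>2(\<Omega> \<times> \<Omega>)\<close>, is closed and densely
  defined. Projecting \<open>(h, 0)\<close> onto the graph of \<open>D\<close> solves \<open>(D\<^sup>* D + 1) u = h\<close> for every \<open>h\<close>, and a
  symmetric operator with surjective \<open>T + 1\<close> is self-adjoint. Closedness of \<open>D\<close> follows from almost
  everywhere convergence of subsequences. Since \<open>|e\<^sup>i\<^sup>\<theta> - 1|\<^sup>2 \<le> C min(1, |x - y|\<^sup>2)\<close> for bounded \<open>A\<close>, and
  \<open>min(1, |z|\<^sup>2) / |z|\<^bsup>N + 2s\<^esup>\<close> is integrable, the domain \<open>W\<^bsup>s,2\<^esup>\<close> of \<open>D\<close> does not depend on \<open>A\<close> and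
  contains all compactly supported Lipschitz functions, hence is dense.
\<close>

section \<open>Projections in semi-inner-product spaces\<close>

text \<open>The argument runs on functions, and classes enter only when graphs are formed, because
  the difference quotient is a pointwise formula. Hence the inner products are degenerate and
  nearest points are determined only up to null sets. The abstract \<open>cmb\<close> lets one
  projection argument serve functions and pairs of functions alike; vectors are compared only
  through \<open>B\<close>, and completeness is supplied separately by each application.

  Two obstacles shape the rest. The domain is defined with the zero field but the form with
  \<open>A\<close>, so both have to be reconciled before closedness can be exploited. And f and
  \<open>A\<close> are only Lebesgue measurable, while Lebesgue measure on pairs is the completion
  of a product and not itself a product: composing with the projections and the midpoint map
  requires that null sets pull back to null sets, and Tonelli's theorem requires Borel
  representatives.\<close>

locale semi_inner_space =
  fixes V :: "'v set"
    and cmb :: "complex \<Rightarrow> 'v \<Rightarrow> complex \<Rightarrow> 'v \<Rightarrow> 'v"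
    and B :: "'v \<Rightarrow> 'v \<Rightarrow> complex"
  assumes cmb_closed: "f \<in> V \<Longrightarrow> g \<in> V \<Longrightarrow> cmb c f d g \<in> V"
    and B_left: "f \<in> V \<Longrightarrow> g \<in> V \<Longrightarrow> h \<in> V \<Longrightarrow> B (cmb c f d g) h = c * B f h + d * B g h"
    and B_sym: "f \<in> V \<Longrightarrow> g \<in> V \<Longrightarrow> B g f = cnj (B f g)"
    and B_nonneg: "f \<in> V \<Longrightarrow> 0 \<le> Re (B f f)"
begin

definition q :: "'v \<Rightarrow> real" where "q f = Re (B f f)"

lemma B_right:
  assumes "f \<in> V" "g \<in> V" "h \<in> V"
  shows "B h (cmb c f d g) = cnj c * B h f + cnj d * B h g"
proof -
  have "B h (cmb c f d g) = cnj (B (cmb c f d g) h)"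
    using assms cmb_closed B_sym by blast
  then show ?thesis
    using assms by (simp add: B_left B_sym[of _ h])
qed

lemma B_self: "f \<in> V \<Longrightarrow> B f f = of_real (q f)"
  using B_sym[of f f] by (simp add: q_def complex_eq_iff)

lemma q_nonneg: "f \<in> V \<Longrightarrow> 0 \<le> q f"
  using B_nonneg by (simp add: q_def)

lemma q_cmb:
  assumes "f \<in> V" "g \<in> V"
  shows "q (cmb c f d g) = (cmod c)\<^sup>2 * q f + (cmod d)\<^sup>2 * q g + 2 * Re (c * cnj d * B f g)"
proof -
  have "B (cmb c f d g) (cmb c f d g) =
      c * cnj c * B f f + d * cnj d * B g g + (c * cnj d * B f g + cnj (c * cnj d * B f g))"
    using assms by (simp add: B_left B_right cmb_closed B_sym[of f g] algebra_simps)
  also have "\<dots> = of_real ((cmod c)\<^sup>2 * q f + (cmod d)\<^sup>2 * q g + 2 * Re (c * cnj d * B f g))"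
    using assms unfolding complex_add_cnj
    by (simp add: B_self complex_norm_square[symmetric])
  finally show ?thesis
    by (simp only: q_def Re_complex_of_real)
qed

text \<open>Expand \<open>q\<close> of f - r B(f, g) g for real r. As \<open>B\<close> may be
  degenerate, the usual choice r = 1 / q g can fail; for \<open>q g = 0\<close> the bound is linear
  in r, and a large r forces \<open>B f g\<close> to vanish.\<close>

lemma Cauchy_Schwarz:
  assumes "f \<in> V" "g \<in> V"
  shows "(cmod (B f g))\<^sup>2 \<le> q f * q g"
proof -
  have *: "0 \<le> q f + r\<^sup>2 * (cmod (B f g))\<^sup>2 * q g - 2 * r * (cmod (B f g))\<^sup>2" for r :: real
  proof -
    have "0 \<le> q (cmb 1 f (- (of_real r * B f g)) g)"
      using assms cmb_closed q_nonneg by blast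
    also have "\<dots> = q f + r\<^sup>2 * (cmod (B f g))\<^sup>2 * q g - 2 * r * Re (B f g * cnj (B f g))"
      using assms by (simp add: q_cmb norm_mult power_mult_distrib algebra_simps)
    also have "B f g * cnj (B f g) = of_real ((cmod (B f g))\<^sup>2)"
      by (rule complex_norm_square[symmetric])
    finally show ?thesis
      by simp
  qed
  show ?thesis
  proof (cases "q g = 0")
    case True
    define b where "b = (cmod (B f g))\<^sup>2"
    have "b \<le> 0"
    proof (rule ccontr)
      assume "\<not> b \<le> 0"
      \<comment> \<open>With r = (q f + 1) / b the inequality \<open>*\<close> would read 0 \<le> q
        f - 2 (q f + 1).\<close>
      then have "(q f + 1) / b * b = q f + 1"
        by simp
      then show False
        using *[of "(q f + 1) / b"] True q_nonneg[OF assms(1)] \<open>\<not> b \<le> 0\<close> by (simp add: b_def[symmetric])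
    qed
    then show ?thesis
      using True by (simp add: b_def)
  next
    case False
    then have pos: "0 < q g"
      using q_nonneg assms by (simp add: order_less_le)
    have "0 \<le> q f - (cmod (B f g))\<^sup>2 / q g"
      using *[of "1 / q g"] pos by (simp add: power2_eq_square)
    then show ?thesis
      using pos by (simp add: field_simps)
  qed
qed

text \<open>The projection theorem, cut off before completeness: \<open>G\<close> minimizes the
  distance from \<open>x\<close> to \<open>S\<close>, and any \<open>p\<close> to which it converges
  has the orthogonality of a nearest point. As \<open>p\<close> ranges over \<open>V\<close>, the
  limit may lie outside \<open>S\<close>.\<close>

lemma projection_sequence:
  assumes S: "S \<subseteq> V" "S \<noteq> {}" "\<And>f g c d. f \<in> S \<Longrightarrow> g \<in> S \<Longrightarrow> cmb c f d g \<in> S" and x: "x \<in> V"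
  obtains G :: "nat \<Rightarrow> 'v" where "\<And>n. G n \<in> S"
    and "\<And>e. 0 < e \<Longrightarrow> \<exists>N. \<forall>m\<ge>N. \<forall>n\<ge>N. q (cmb 1 (G m) (-1) (G n)) < e"
    and "\<And>p y. p \<in> V \<Longrightarrow> (\<lambda>n. q (cmb 1 (G n) (-1) p)) \<longlonglongrightarrow> 0 \<Longrightarrow> y \<in> S \<Longrightarrow> B (cmb 1 x (-1) p) y = 0"
proof -
  define \<delta> where "\<delta> = (INF g\<in>S. q (cmb 1 x (-1) g))"
  have bdd: "bdd_below ((\<lambda>g. q (cmb 1 x (-1) g)) ` S)"
    using S(1) x by (intro bdd_belowI2[where m = 0]) (auto intro: q_nonneg cmb_closed)
  have lower: "\<delta> \<le> q (cmb 1 x (-1) g)" if "g \<in> S" for g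
    unfolding \<delta>_def using bdd that by (rule cINF_lower)
  have "\<exists>g\<in>S. q (cmb 1 x (-1) g) < \<delta> + inverse (real (Suc n))" for n
  proof -
    have "\<delta> < \<delta> + inverse (real (Suc n))"
      by simp
    then show ?thesis
      unfolding \<delta>_def cINF_less_iff[OF S(2) bdd] .
  qed
  then obtain G where G: "\<And>n. G n \<in> S" "\<And>n. q (cmb 1 x (-1) (G n)) < \<delta> + inverse (real (Suc n))"
    by metis
  have GV: "G n \<in> V" for n
    using G(1) S(1) by blast
  \<comment> \<open>Parallelogram law for x - G m and x - G n. The midpoint of \<open>G m\<close>
    and \<open>G n\<close> lies in \<open>S\<close>, so its squared distance from x is at least
    \<open>\<delta>\<close>, and the multiples of \<open>\<delta>\<close> cancel.\<close>
  have quad: "q (cmb 1 (G m) (-1) (G n)) < 2 * inverse (real (Suc m)) + 2 * inverse (real (Suc n))" for m n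
  proof -
    have "q (cmb 1 (G m) (-1) (G n)) = 2 * q (cmb 1 x (-1) (G m)) + 2 * q (cmb 1 x (-1) (G n))
        - 4 * q (cmb 1 x (-1) (cmb (1/2) (G m) (1/2) (G n)))"
      using GV x by (simp add: q_cmb cmb_closed B_right power2_eq_square field_simps)
    moreover have "\<delta> \<le> q (cmb 1 x (-1) (cmb (1/2) (G m) (1/2) (G n)))"
      by (intro lower S(3) G(1))
    ultimately show ?thesis
      using G(2)[of m] G(2)[of n] by linarith
  qed
  show thesis
  proof (rule that[OF G(1)])
    fix e :: real
    assume "0 < e"
    then obtain N where N: "inverse (real (Suc N)) < e / 4"
      using reals_Archimedean[of "e / 4"] by auto
    show "\<exists>N. \<forall>m\<ge>N. \<forall>n\<ge>N. q (cmb 1 (G m) (-1) (G n)) < e"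
    proof (intro exI allI impI)
      fix m n
      assume "N \<le> m" "N \<le> n"
      then have "inverse (real (Suc m)) \<le> inverse (real (Suc N))"
        "inverse (real (Suc n)) \<le> inverse (real (Suc N))"
        by (auto intro!: le_imp_inverse_le)
      then show "q (cmb 1 (G m) (-1) (G n)) < e"
        using quad[of m n] N by linarith
    qed
  next
    fix p y
    assume p: "p \<in> V" and lim: "(\<lambda>n. q (cmb 1 (G n) (-1) p)) \<longlonglongrightarrow> 0" and y: "y \<in> S"
    have yV: "y \<in> V"
      using y S(1) by blast
    define b where "b = B (cmb 1 x (-1) p) y"
    have "(\<lambda>n. B (cmb 1 (G n) (-1) p) y) \<longlonglongrightarrow> 0"
    proof (rule Lim_null_comparison)
      show "\<forall>\<^sub>F n in sequentially. norm (B (cmb 1 (G n) (-1) p) y) \<le> sqrt (q (cmb 1 (G n) (-1) p) * q y)"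
        using Cauchy_Schwarz[OF cmb_closed[OF GV p] yV] by (intro always_eventually allI real_le_rsqrt) auto
      show "(\<lambda>n. sqrt (q (cmb 1 (G n) (-1) p) * q y)) \<longlonglongrightarrow> 0"
        using tendsto_real_sqrt[OF tendsto_mult_right[OF lim, of "q y"]] by simp
    qed
    then have "(\<lambda>n. b - B (cmb 1 (G n) (-1) p) y) \<longlonglongrightarrow> b - 0"
      by (intro tendsto_intros)
    then have limB: "(\<lambda>n. B (cmb 1 x (-1) (G n)) y) \<longlonglongrightarrow> b"
      using GV p x yV by (simp add: b_def B_left)
    \<comment> \<open>Compare with the competitors G n + r b y. The factor b makes the first-order
      term real, namely 2 r |b|^2 in the limit; for small positive r it would exceed the term of
      order r^2 unless b = 0.\<close>
    have bound: "2 * r * (cmod b)\<^sup>2 \<le> r\<^sup>2 * (cmod b)\<^sup>2 * q y" for r :: real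
    proof -
      have "2 * Re (of_real r * cnj b * B (cmb 1 x (-1) (G n)) y) \<le> inverse (real (Suc n)) + r\<^sup>2 * (cmod b)\<^sup>2 * q y" for n
      proof -
        have "\<delta> \<le> q (cmb 1 x (-1) (cmb 1 (G n) (of_real r * b) y))"
          by (intro lower S(3) G(1) y)
        also have "\<dots> = q (cmb 1 x (-1) (G n)) + r\<^sup>2 * (cmod b)\<^sup>2 * q y
            - 2 * Re (of_real r * cnj b * B (cmb 1 x (-1) (G n)) y)"
          using GV x yV by (simp add: q_cmb cmb_closed B_left B_right norm_mult power_mult_distrib algebra_simps)
        finally show ?thesis
          using G(2)[of n] by linarith
      qed
      moreover have "(\<lambda>n. 2 * Re (of_real r * cnj b * B (cmb 1 x (-1) (G n)) y)) \<longlonglongrightarrow> 2 * Re (of_real r * cnj b * b)"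
        by (intro tendsto_intros limB)
      moreover have "(\<lambda>n. inverse (real (Suc n)) + r\<^sup>2 * (cmod b)\<^sup>2 * q y) \<longlonglongrightarrow> 0 + r\<^sup>2 * (cmod b)\<^sup>2 * q y"
        by (intro tendsto_intros LIMSEQ_inverse_real_of_nat)
      ultimately have "2 * Re (of_real r * cnj b * b) \<le> r\<^sup>2 * (cmod b)\<^sup>2 * q y"
        by (intro LIMSEQ_le) auto
      moreover have "of_real r * cnj b * b = complex_of_real (r * (cmod b)\<^sup>2)"
        by (simp only: of_real_mult complex_norm_square mult.assoc mult.commute[of b])
      ultimately show ?thesis
        by (metis Re_complex_of_real mult.assoc)
    qed
    have "b = 0"
    proof (rule ccontr)
      assume "b \<noteq> 0"
      then have "2 \<le> r * q y" if "0 < r" for r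
        using bound[of r] that by (simp add: power2_eq_square field_simps)
      from this[of "1 / (q y + 1)"] show False
        using q_nonneg[OF yV] by (simp add: field_simps)
    qed
    then show "B (cmb 1 x (-1) p) y = 0"
      by (simp add: b_def)
  qed
qed

end

section \<open>Completeness of \<open>L\<^sup>2\<close>\<close>

definition L2_ip :: "'a measure \<Rightarrow> ('a \<Rightarrow> complex) \<Rightarrow> ('a \<Rightarrow> complex) \<Rightarrow> complex" where
  "L2_ip M f g = (\<integral>x. f x * cnj (g x) \<partial>M)"

abbreviation lincomb :: "complex \<Rightarrow> ('a \<Rightarrow> complex) \<Rightarrow> complex \<Rightarrow> ('a \<Rightarrow> complex) \<Rightarrow> 'a \<Rightarrow> complex" where
  "lincomb c f d g \<equiv> \<lambda>x. c * f x + d * g x"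

lemma borel_measurable_cnj [measurable]: "cnj \<in> borel_measurable borel"
  by (intro borel_measurable_continuous_onI continuous_intros)

lemma L2_fun_measurable [measurable_dest, dest]: "f \<in> L2_fun M \<Longrightarrow> f \<in> borel_measurable M"
  by (simp add: L2_fun_def)

lemma L2_fun_iff_nn_integral:
  assumes "f \<in> borel_measurable M"
  shows "f \<in> L2_fun M \<longleftrightarrow> (\<integral>\<^sup>+x. ennreal ((cmod (f x))\<^sup>2) \<partial>M) < \<infinity>"
  using assms unfolding L2_fun_def by (simp add: integrable_iff_bounded)

lemma sum_square_bound: "(a + b)\<^sup>2 \<le> 2 * a\<^sup>2 + 2 * (b::real)\<^sup>2"
  using zero_le_power2[of "a - b"] by (simp add: power2_eq_square algebra_simps)

lemma L2_fun_mult_integrable: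
  assumes "f \<in> L2_fun M" "g \<in> L2_fun M"
  shows "integrable M (\<lambda>x. f x * cnj (g x))"
proof (rule Bochner_Integration.integrable_bound)
  show "integrable M (\<lambda>x. (cmod (f x))\<^sup>2 + (cmod (g x))\<^sup>2)"
    using assms by (auto simp: L2_fun_def)
  show "(\<lambda>x. f x * cnj (g x)) \<in> borel_measurable M"
    using assms by measurable
  have "a * b \<le> a\<^sup>2 + b\<^sup>2" if "0 \<le> a" "0 \<le> b" for a b :: real
    using sum_squares_bound[of a b] mult_nonneg_nonneg[OF that] by linarith
  then show "AE x in M. norm (f x * cnj (g x)) \<le> norm ((cmod (f x))\<^sup>2 + (cmod (g x))\<^sup>2)"
    by (simp add: norm_mult)
qed

lemma L2_fun_lincomb:
  assumes "f \<in> L2_fun M" "g \<in> L2_fun M"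
  shows "lincomb c f d g \<in> L2_fun M"
proof -
  have "integrable M (\<lambda>x. (cmod (c * f x + d * g x))\<^sup>2)"
  proof (rule Bochner_Integration.integrable_bound)
    show "integrable M (\<lambda>x. 2 * (cmod c)\<^sup>2 * (cmod (f x))\<^sup>2 + 2 * (cmod d)\<^sup>2 * (cmod (g x))\<^sup>2)"
      using assms by (auto simp: L2_fun_def)
    show "(\<lambda>x. (cmod (c * f x + d * g x))\<^sup>2) \<in> borel_measurable M"
      using assms by measurable
    have "(cmod (c * f x + d * g x))\<^sup>2 \<le> 2 * (cmod c)\<^sup>2 * (cmod (f x))\<^sup>2 + 2 * (cmod d)\<^sup>2 * (cmod (g x))\<^sup>2" for x
    proof -
      have "(cmod (c * f x + d * g x))\<^sup>2 \<le> (cmod (c * f x) + cmod (d * g x))\<^sup>2"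
        by (intro power_mono norm_triangle_ineq norm_ge_zero)
      also have "\<dots> \<le> 2 * (cmod (c * f x))\<^sup>2 + 2 * (cmod (d * g x))\<^sup>2"
        by (rule sum_square_bound)
      finally show ?thesis
        by (simp add: norm_mult power_mult_distrib)
    qed
    then show "AE x in M. norm ((cmod (c * f x + d * g x))\<^sup>2)
        \<le> norm (2 * (cmod c)\<^sup>2 * (cmod (f x))\<^sup>2 + 2 * (cmod d)\<^sup>2 * (cmod (g x))\<^sup>2)"
      by simp
  qed
  moreover have "lincomb c f d g \<in> borel_measurable M"
    using assms by measurable
  ultimately show ?thesis
    by (simp add: L2_fun_def)
qed

lemma L2_fun_cong_AE:
  assumes "f \<in> L2_fun M" "g \<in> borel_measurable M" "AE x in M. g x = f x"
  shows "g \<in> L2_fun M"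
proof -
  have "(\<integral>\<^sup>+x. ennreal ((cmod (g x))\<^sup>2) \<partial>M) = (\<integral>\<^sup>+x. ennreal ((cmod (f x))\<^sup>2) \<partial>M)"
    by (intro nn_integral_cong_AE) (use assms(3) in eventually_elim, simp)
  then show ?thesis
    using assms L2_fun_iff_nn_integral[of f] L2_fun_iff_nn_integral[of g] L2_fun_measurable by metis
qed

lemma L2_ip_lincomb:
  assumes "f \<in> L2_fun M" "g \<in> L2_fun M" "h \<in> L2_fun M"
  shows "L2_ip M (lincomb c f d g) h = c * L2_ip M f h + d * L2_ip M g h"
proof -
  have "L2_ip M (lincomb c f d g) h = (\<integral>x. c * (f x * cnj (h x)) + d * (g x * cnj (h x)) \<partial>M)"
    by (simp add: L2_ip_def algebra_simps)
  then show ?thesis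
    using L2_fun_mult_integrable[OF assms(1,3)] L2_fun_mult_integrable[OF assms(2,3)]
    by (simp add: L2_ip_def)
qed

lemma L2_ip_sym: "L2_ip M g f = cnj (L2_ip M f g)"
proof -
  have "cnj (L2_ip M f g) = (\<integral>x. cnj (f x * cnj (g x)) \<partial>M)"
    unfolding L2_ip_def by (rule Bochner_Integration.integral_cnj[symmetric])
  then show ?thesis
    by (simp add: L2_ip_def mult.commute)
qed

lemma L2_ip_self: "L2_ip M f f = of_real (\<integral>x. (cmod (f x))\<^sup>2 \<partial>M)"
  unfolding L2_ip_def integral_complex_of_real[symmetric] complex_norm_square ..

lemma L2_semi_inner_space: "semi_inner_space (L2_fun M) lincomb (L2_ip M)"
  by standard (auto intro: L2_fun_lincomb L2_ip_lincomb L2_ip_sym simp: L2_ip_self)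

lemma L2_ip_cong_AE:
  assumes "f \<in> L2_fun M" "f' \<in> L2_fun M" "g \<in> L2_fun M" "g' \<in> L2_fun M"
    and "AE x in M. f x = f' x" "AE x in M. g x = g' x"
  shows "L2_ip M f g = L2_ip M f' g'"
proof -
  have [measurable]: "f \<in> borel_measurable M" "f' \<in> borel_measurable M"
    "g \<in> borel_measurable M" "g' \<in> borel_measurable M"
    using assms by auto
  show ?thesis
    unfolding L2_ip_def
    by (intro integral_cong_AE) (measurable, use assms(5,6) in eventually_elim, simp)
qed

lemma L2_ip_self_eq_0:
  assumes "f \<in> L2_fun M"
  shows "Re (L2_ip M f f) = 0 \<longleftrightarrow> (AE x in M. f x = 0)"
  using assms integral_nonneg_eq_0_iff_AE[of M "\<lambda>x. (cmod (f x))\<^sup>2"]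
  by (simp add: L2_ip_self L2_fun_def)

lemma nn_integral_eq_L2_ip:
  assumes "f \<in> L2_fun M"
  shows "(\<integral>\<^sup>+x. ennreal ((cmod (f x))\<^sup>2) \<partial>M) = ennreal (Re (L2_ip M f f))"
  using assms by (simp add: L2_ip_self L2_fun_def nn_integral_eq_integral)

text \<open>A subsequence with \<open>\<parallel>f(r (k + 1)) - f(r k)\<parallel>\<^sup>2 < 8\<^sup>-\<^sup>k\<close> converges almost everywhere,
  because \<open>\<Sum>k. 4^k \<parallel>f(r (k + 1)) - f(r k)\<parallel>\<^sup>2\<close> is finite.\<close>

lemma L2_Cauchy_AE_subseq:
  assumes f: "\<And>n. f n \<in> L2_fun M"
    and Cauchy: "\<And>e. 0 < e \<Longrightarrow>
      \<exists>N. \<forall>m\<ge>N. \<forall>n\<ge>N. Re (L2_ip M (lincomb 1 (f m) (-1) (f n)) (lincomb 1 (f m) (-1) (f n))) < e"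
  obtains r :: "nat \<Rightarrow> nat" where "strict_mono r" "AE x in M. convergent (\<lambda>k. f (r k) x)"
proof -
  let ?D = "\<lambda>m n x. f m x - f n x"
  have [measurable]: "f n \<in> borel_measurable M" for n
    using f by measurable
  have "\<exists>N. \<forall>m\<ge>N. \<forall>n\<ge>N. (\<integral>\<^sup>+x. ennreal ((cmod (?D m n x))\<^sup>2) \<partial>M) \<le> ennreal ((1/8) ^ k)" for k
  proof -
    obtain N where N: "\<forall>m\<ge>N. \<forall>n\<ge>N. Re (L2_ip M (lincomb 1 (f m) (-1) (f n)) (lincomb 1 (f m) (-1) (f n))) < (1/8) ^ k"
      using Cauchy[of "(1/8) ^ k"] by auto
    have "(\<integral>\<^sup>+x. ennreal ((cmod (?D m n x))\<^sup>2) \<partial>M) \<le> ennreal ((1/8) ^ k)" if "m \<ge> N" "n \<ge> N" for m n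
      using nn_integral_eq_L2_ip[OF L2_fun_lincomb[OF f[of m] f[of n], of 1 "-1"]] N that
      by (simp add: less_imp_le ennreal_leI)
    then show ?thesis
      by blast
  qed
  then obtain N where N: "\<And>k m n. N k \<le> m \<Longrightarrow> N k \<le> n \<Longrightarrow>
      (\<integral>\<^sup>+x. ennreal ((cmod (?D m n x))\<^sup>2) \<partial>M) \<le> ennreal ((1/8) ^ k)"
    by metis
  \<comment> \<open>The maximum secures both strict growth and \<open>N k \<le> r k\<close>.\<close>
  define r where "r = rec_nat (N 0) (\<lambda>k a. max (Suc a) (N (Suc k)))"
  have r_Suc: "r (Suc k) = max (Suc (r k)) (N (Suc k))" for k
    by (simp add: r_def)
  have mono: "strict_mono r"
    by (simp add: strict_mono_Suc_iff r_Suc less_max_iff_disj)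
  have N_le: "N k \<le> r k" for k
    by (cases k) (simp_all add: r_Suc, simp add: r_def)
  let ?g = "\<lambda>k x. ennreal (4 ^ k * (cmod (?D (r (Suc k)) (r k) x))\<^sup>2)"
  have "(\<integral>\<^sup>+x. (\<Sum>k. ?g k x) \<partial>M) = (\<Sum>k. \<integral>\<^sup>+x. ?g k x \<partial>M)"
    by (rule nn_integral_suminf) measurable
  also have "\<dots> \<le> (\<Sum>k. ennreal ((1/2) ^ k))"
  proof (intro suminf_le summableI)
    fix k
    have "(\<integral>\<^sup>+x. ?g k x \<partial>M) = ennreal (4 ^ k) * (\<integral>\<^sup>+x. ennreal ((cmod (?D (r (Suc k)) (r k) x))\<^sup>2) \<partial>M)"
      by (subst nn_integral_cmult[symmetric]) (auto simp: ennreal_mult)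
    also have "\<dots> \<le> ennreal (4 ^ k) * ennreal ((1/8) ^ k)"
      using N_le[of k] strict_monoD[OF mono, of k "Suc k"] by (intro mult_left_mono N) auto
    also have "\<dots> = ennreal (4 ^ k * (1/8) ^ k)"
      by (simp add: ennreal_mult)
    also have "4 ^ k * (1/8) ^ k = (1/2::real) ^ k"
      by (simp add: power_mult_distrib[symmetric])
    finally show "(\<integral>\<^sup>+x. ?g k x \<partial>M) \<le> ennreal ((1/2) ^ k)" .
  qed
  also have "\<dots> < \<infinity>"
    by (subst suminf_ennreal2) (auto intro: summable_geometric)
  finally have "(\<integral>\<^sup>+x. (\<Sum>k. ?g k x) \<partial>M) \<noteq> \<infinity>"
    by simp
  then have "AE x in M. (\<Sum>k. ?g k x) \<noteq> \<infinity>"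
    by (intro nn_integral_noteq_infinite) measurable
  then have "AE x in M. convergent (\<lambda>k. f (r k) x)"
  proof eventually_elim
    case (elim x)
    then have "summable (\<lambda>k. 4 ^ k * (cmod (?D (r (Suc k)) (r k) x))\<^sup>2)"
      by (intro summable_suminf_not_top) (auto simp: top_ennreal_def[symmetric])
    \<comment> \<open>Boundedness of the summands is enough: dividing by the weight 4^k and taking
      roots bounds the increments by a geometric series of ratio 1/2.\<close>
    then have "Bseq (\<lambda>k. 4 ^ k * (cmod (?D (r (Suc k)) (r k) x))\<^sup>2)"
      by (intro convergent_imp_Bseq) (auto dest: summable_LIMSEQ_zero simp: convergent_def)
    then obtain K where K: "0 < K" "\<And>k. 4 ^ k * (cmod (?D (r (Suc k)) (r k) x))\<^sup>2 \<le> K"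
      by (auto simp: Bseq_def)
    have "cmod (?D (r (Suc k)) (r k) x) \<le> sqrt K * (1/2) ^ k" for k
    proof (rule power2_le_imp_le)
      have "(cmod (?D (r (Suc k)) (r k) x))\<^sup>2 \<le> K / 4 ^ k"
        using K(2)[of k] by (simp add: field_simps)
      also have "\<dots> = (sqrt K * (1/2) ^ k)\<^sup>2"
        using K(1) by (simp add: power_mult_distrib power_divide power_mult[symmetric] mult.commute[of k] power_mult)
      finally show "(cmod (?D (r (Suc k)) (r k) x))\<^sup>2 \<le> (sqrt K * (1/2) ^ k)\<^sup>2" .
      show "0 \<le> sqrt K * (1/2) ^ k"
        using K(1) by simp
    qed
    then have "summable (\<lambda>k. f (r (Suc k)) x - f (r k) x)"
      by (intro summable_comparison_test'[where N = 0, OF summable_mult[OF summable_geometric]]) auto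
    then have "convergent (\<lambda>n. f (r 0) x + (\<Sum>k<n. f (r (Suc k)) x - f (r k) x))"
      by (simp add: summable_iff_convergent convergent_add_const_iff)
    moreover have "f (r 0) x + (\<Sum>k<n. f (r (Suc k)) x - f (r k) x) = f (r n) x" for n
      by (simp only: sum_lessThan_telescope[where f = "\<lambda>k. f (r k) x"]) simp
    ultimately show ?case
      by (simp only:)
  qed
  then show thesis
    using mono that by blast
qed

text \<open>The candidate is the almost everywhere limit of a subsequence. Fatou's lemma for |f n -
  f (r k)|^2, with n fixed and k growing, turns the Cauchy bound into a bound on the distance from
  \<open>f n\<close> to the candidate, so the whole sequence converges.\<close>

lemma L2_complete:
  assumes f: "\<And>n. f n \<in> L2_fun M"
    and Cauchy: "\<And>e. 0 < e \<Longrightarrow>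
      \<exists>N. \<forall>m\<ge>N. \<forall>n\<ge>N. Re (L2_ip M (lincomb 1 (f m) (-1) (f n)) (lincomb 1 (f m) (-1) (f n))) < e"
  obtains l where "l \<in> L2_fun M"
    "(\<lambda>n. Re (L2_ip M (lincomb 1 (f n) (-1) l) (lincomb 1 (f n) (-1) l))) \<longlonglongrightarrow> 0"
proof -
  have [measurable]: "f n \<in> borel_measurable M" for n
    using f by measurable
  obtain r where r: "strict_mono r" "AE x in M. convergent (\<lambda>k. f (r k) x)"
    using L2_Cauchy_AE_subseq[OF f Cauchy] by blast
  \<comment> \<open>Where the subsequence diverges, \<open>lim\<close> has an unspecified value;
    this happens only on a null set.\<close>
  define l where "l x = lim (\<lambda>k. f (r k) x)" for x
  have l_meas [measurable]: "l \<in> borel_measurable M"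
    unfolding l_def by measurable
  have fatou: "\<exists>N. \<forall>n\<ge>N. (\<integral>\<^sup>+x. ennreal ((cmod (f n x - l x))\<^sup>2) \<partial>M) \<le> ennreal e" if "0 < e" for e
  proof -
    obtain N where N: "\<forall>m\<ge>N. \<forall>n\<ge>N. Re (L2_ip M (lincomb 1 (f m) (-1) (f n)) (lincomb 1 (f m) (-1) (f n))) < e"
      using Cauchy \<open>0 < e\<close> by blast
    have "(\<integral>\<^sup>+x. ennreal ((cmod (f n x - l x))\<^sup>2) \<partial>M) \<le> ennreal e" if "N \<le> n" for n
    proof -
      have "(\<integral>\<^sup>+x. ennreal ((cmod (f n x - l x))\<^sup>2) \<partial>M)
          = (\<integral>\<^sup>+x. liminf (\<lambda>k. ennreal ((cmod (f n x - f (r k) x))\<^sup>2)) \<partial>M)"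
      proof (rule nn_integral_cong_AE)
        show "AE x in M. ennreal ((cmod (f n x - l x))\<^sup>2) = liminf (\<lambda>k. ennreal ((cmod (f n x - f (r k) x))\<^sup>2))"
          using r(2)
        proof eventually_elim
          case (elim x)
          then have "(\<lambda>k. f (r k) x) \<longlonglongrightarrow> l x"
            by (simp add: l_def convergent_LIMSEQ_iff)
          then have "(\<lambda>k. ennreal ((cmod (f n x - f (r k) x))\<^sup>2)) \<longlonglongrightarrow> ennreal ((cmod (f n x - l x))\<^sup>2)"
            by (intro tendsto_ennrealI tendsto_intros)
          then show ?case
            by (intro lim_imp_Liminf[symmetric]) auto
        qed
      qed
      also have "\<dots> \<le> liminf (\<lambda>k. \<integral>\<^sup>+x. ennreal ((cmod (f n x - f (r k) x))\<^sup>2) \<partial>M)"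
        by (rule nn_integral_liminf) measurable
      also have "\<dots> \<le> liminf (\<lambda>k. ennreal e)"
      proof (rule Liminf_mono, rule eventually_sequentiallyI[of N])
        fix k
        assume "N \<le> k"
        then have "N \<le> r k"
          using seq_suble[OF r(1), of k] by simp
        then show "(\<integral>\<^sup>+x. ennreal ((cmod (f n x - f (r k) x))\<^sup>2) \<partial>M) \<le> ennreal e"
          using nn_integral_eq_L2_ip[OF L2_fun_lincomb[OF f[of n] f[of "r k"], of 1 "-1"]] N \<open>N \<le> n\<close>
          by (simp add: less_imp_le ennreal_leI)
      qed
      also have "\<dots> = ennreal e"
        by (simp add: Liminf_const)
      finally show ?thesis .
    qed
    then show ?thesis
      by blast
  qed
  \<comment> \<open>One finite distance to some \<open>f N\<close> puts \<open>l\<close> itself into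
    L^2.\<close>
  obtain N where "\<forall>n\<ge>N. (\<integral>\<^sup>+x. ennreal ((cmod (f n x - l x))\<^sup>2) \<partial>M) \<le> ennreal 1"
    using fatou[of 1] by auto
  then have "(\<lambda>x. f N x - l x) \<in> L2_fun M"
    by (subst L2_fun_iff_nn_integral) (auto simp: le_less_trans)
  from L2_fun_lincomb[OF f[of N] this, of 1 "-1"] have l: "l \<in> L2_fun M"
    by simp
  show thesis
  proof (rule that[OF l], rule LIMSEQ_I)
    fix e :: real
    assume "0 < e"
    then obtain N where N: "\<forall>n\<ge>N. (\<integral>\<^sup>+x. ennreal ((cmod (f n x - l x))\<^sup>2) \<partial>M) \<le> ennreal (e / 2)"
      using fatou[of "e / 2"] by auto
    show "\<exists>N. \<forall>n\<ge>N. norm (Re (L2_ip M (lincomb 1 (f n) (-1) l) (lincomb 1 (f n) (-1) l)) - 0) < e"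
    proof (intro exI allI impI)
      fix n
      assume "N \<le> n"
      then have "ennreal (Re (L2_ip M (lincomb 1 (f n) (-1) l) (lincomb 1 (f n) (-1) l))) \<le> ennreal (e / 2)"
        using N[rule_format, of n] nn_integral_eq_L2_ip[OF L2_fun_lincomb[OF f[of n] l, of 1 "-1"]] by simp
      then have "Re (L2_ip M (lincomb 1 (f n) (-1) l) (lincomb 1 (f n) (-1) l)) \<le> e / 2"
        using \<open>0 < e\<close> by (simp add: ennreal_le_iff)
      moreover have "0 \<le> Re (L2_ip M (lincomb 1 (f n) (-1) l) (lincomb 1 (f n) (-1) l))"
        by (simp add: L2_ip_self)
      ultimately show "norm (Re (L2_ip M (lincomb 1 (f n) (-1) l) (lincomb 1 (f n) (-1) l)) - 0) < e"
        using \<open>0 < e\<close> by simp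
    qed
  qed
qed

section \<open>Von Neumann's theorem\<close>

text \<open>Mean-square convergence is L^1 convergence of |f n - l|^2 to 0. This supplies the
  pointwise limits from which closedness is deduced.\<close>

lemma L2_AE_subseq:
  assumes f: "\<And>n. f n \<in> L2_fun M" and l: "l \<in> L2_fun M"
    and lim: "(\<lambda>n. Re (L2_ip M (lincomb 1 (f n) (-1) l) (lincomb 1 (f n) (-1) l))) \<longlonglongrightarrow> 0"
  obtains r :: "nat \<Rightarrow> nat" where "strict_mono r" "AE x in M. (\<lambda>k. f (r k) x) \<longlonglongrightarrow> l x"
proof -
  have eq: "Re (L2_ip M (lincomb 1 (f n) (-1) l) (lincomb 1 (f n) (-1) l)) = (\<integral>x. norm ((cmod (f n x - l x))\<^sup>2) \<partial>M)" for n
    by (simp add: L2_ip_self)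
  have "integrable M (\<lambda>x. (cmod (f n x - l x))\<^sup>2)" for n
    using L2_fun_lincomb[OF f[of n] l, of 1 "-1"] by (simp add: L2_fun_def)
  from tendsto_L1_AE_subseq[OF this lim[unfolded eq]]
  obtain r where r: "strict_mono r" "AE x in M. (\<lambda>n. (cmod (f (r n) x - l x))\<^sup>2) \<longlonglongrightarrow> 0"
    by blast
  from r(2) have "AE x in M. (\<lambda>k. f (r k) x) \<longlonglongrightarrow> l x"
  proof eventually_elim
    case (elim x)
    then have "(\<lambda>n. sqrt ((cmod (f (r n) x - l x))\<^sup>2)) \<longlonglongrightarrow> sqrt 0"
      by (rule tendsto_real_sqrt)
    then have "(\<lambda>n. f (r n) x - l x) \<longlonglongrightarrow> 0"
      by (simp add: tendsto_norm_zero_iff)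
    then show ?case
      by (rule LIM_zero_cancel)
  qed
  with r(1) show thesis
    by (rule that)
qed

lemma L2_class_eq_iff:
  assumes "f \<in> L2_fun M" "g \<in> L2_fun M"
  shows "L2_class M f = L2_class M g \<longleftrightarrow> (AE x in M. f x = g x)"
proof
  assume "L2_class M f = L2_class M g"
  then have "f \<in> L2_class M g"
    using assms by (auto simp: L2_class_def)
  then show "AE x in M. f x = g x"
    by (simp add: L2_class_def)
next
  assume eq: "AE x in M. f x = g x"
  have "(AE x in M. u x = f x) \<longleftrightarrow> (AE x in M. u x = g x)" for u
    by (rule eventually_subst) (use eq in eventually_elim, simp)
  then show "L2_class M f = L2_class M g"
    by (simp add: L2_class_def)
qed

lemma L2_inner_class_ip:
  "f \<in> L2_fun M \<Longrightarrow> g \<in> L2_fun M \<Longrightarrow> L2_inner M (L2_class M f) (L2_class M g) = L2_ip M f g"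
  by (simp add: L2_inner_class L2_ip_def)

text \<open>\<open>D\<close> maps functions rather than classes; \<open>closed\<close>, applied to
  constant sequences, makes \<open>V\<close> and \<open>D\<close> respect almost everywhere
  equality. \<open>dense\<close> is phrased as triviality of the orthogonal complement, which is
  what testing with cutoffs provides.\<close>

locale closed_dense_operator =
  fixes M :: "'a measure" and M' :: "'b measure"
    and V :: "('a \<Rightarrow> complex) set" and D :: "('a \<Rightarrow> complex) \<Rightarrow> 'b \<Rightarrow> complex"
  assumes V_L2: "f \<in> V \<Longrightarrow> f \<in> L2_fun M"
    and D_L2: "f \<in> V \<Longrightarrow> D f \<in> L2_fun M'"
    and V_nonempty: "V \<noteq> {}"
    and V_lincomb: "f \<in> V \<Longrightarrow> g \<in> V \<Longrightarrow> lincomb c f d g \<in> V"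
    and D_lincomb: "f \<in> V \<Longrightarrow> g \<in> V \<Longrightarrow> D (lincomb c f d g) = lincomb c (D f) d (D g)"
    and closed: "(\<And>n. F n \<in> V) \<Longrightarrow> f \<in> L2_fun M \<Longrightarrow> k \<in> L2_fun M' \<Longrightarrow>
      (\<lambda>n. Re (L2_ip M (lincomb 1 (F n) (-1) f) (lincomb 1 (F n) (-1) f))) \<longlonglongrightarrow> 0 \<Longrightarrow>
      (\<lambda>n. Re (L2_ip M' (lincomb 1 (D (F n)) (-1) k) (lincomb 1 (D (F n)) (-1) k))) \<longlonglongrightarrow> 0 \<Longrightarrow>
      f \<in> V \<and> (AE x in M'. D f x = k x)"
    and dense: "h \<in> L2_fun M \<Longrightarrow> (\<And>g. g \<in> V \<Longrightarrow> L2_ip M h g = 0) \<Longrightarrow> AE x in M. h x = 0"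
begin

text \<open>This is D^* D f = h, written against test functions so that the adjoint of
  \<open>D\<close> never has to be constructed.\<close>

definition weak_solution :: "('a \<Rightarrow> complex) \<Rightarrow> ('a \<Rightarrow> complex) \<Rightarrow> bool" where
  "weak_solution f h \<longleftrightarrow> f \<in> V \<and> h \<in> L2_fun M \<and> (\<forall>g\<in>V. L2_ip M' (D f) (D g) = L2_ip M h g)"

definition graph :: "(('a \<Rightarrow> complex) set \<times> ('a \<Rightarrow> complex) set) set" where
  "graph = {(L2_class M f, L2_class M h) | f h. weak_solution f h}"

lemma graphI: "weak_solution f h \<Longrightarrow> (L2_class M f, L2_class M h) \<in> graph"
  unfolding graph_def by blast

lemma weakD:
  assumes "weak_solution f h"
  shows "f \<in> V" "f \<in> L2_fun M" "h \<in> L2_fun M" "D f \<in> L2_fun M'"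
    "g \<in> V \<Longrightarrow> L2_ip M' (D f) (D g) = L2_ip M h g"
  using assms V_L2 D_L2 by (auto simp: weak_solution_def)

text \<open>In the degenerate norm the constant sequence f converges to f', and its images are
  constantly \<open>D f\<close>; closedness does the rest.\<close>

lemma V_cong_AE:
  assumes f: "f \<in> V" and f': "f' \<in> L2_fun M" and eq: "AE x in M. f' x = f x"
  shows "f' \<in> V" "AE x in M'. D f' x = D f x"
proof -
  have "AE x in M. 1 * f x + (-1) * f' x = 0"
    using eq by eventually_elim simp
  then have "Re (L2_ip M (lincomb 1 f (-1) f') (lincomb 1 f (-1) f')) = 0"
    using L2_ip_self_eq_0[OF L2_fun_lincomb[OF V_L2[OF f] f', of 1 "-1"]] by simp
  moreover have "Re (L2_ip M' (lincomb 1 (D f) (-1) (D f)) (lincomb 1 (D f) (-1) (D f))) = 0"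
    by (simp add: L2_ip_def)
  ultimately have "f' \<in> V \<and> (AE x in M'. D f' x = D f x)"
    using closed[of "\<lambda>_. f" f' "D f"] f f' D_L2[OF f] by simp
  then show "f' \<in> V" "AE x in M'. D f' x = D f x"
    by blast+
qed

text \<open>The solution is the first component of the projection of \<open>(h, 0)\<close> onto the graph of \<open>D\<close>
  in the Hilbert space \<open>L\<^sup>2(M) \<oplus> L\<^sup>2(M')\<close>.\<close>

lemma resolvent:
  assumes h: "h \<in> L2_fun M"
  obtains u where "weak_solution u (lincomb 1 h (-1) u)"
proof -
  define H where "H = L2_fun M \<times> L2_fun M'"
  define cmb where "cmb = (\<lambda>c (F :: ('a \<Rightarrow> complex) \<times> ('b \<Rightarrow> complex)) d G.
    (lincomb c (fst F) d (fst G), lincomb c (snd F) d (snd G)))"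
  define B where "B = (\<lambda>F G. L2_ip M (fst F) (fst G) + L2_ip M' (snd F) (snd G))"
  interpret H: semi_inner_space H cmb B
  proof
    fix f g h :: "('a \<Rightarrow> complex) \<times> ('b \<Rightarrow> complex)" and c d :: complex
    assume fg: "f \<in> H" "g \<in> H"
    show "cmb c f d g \<in> H"
      using fg by (auto simp: H_def cmb_def intro: L2_fun_lincomb)
    show "B g f = cnj (B f g)"
      by (simp add: B_def L2_ip_sym[of _ "fst g"] L2_ip_sym[of _ "snd g"])
    assume "h \<in> H"
    then show "B (cmb c f d g) h = c * B f h + d * B g h"
      using fg by (auto simp: H_def cmb_def B_def L2_ip_lincomb algebra_simps)
  next
    fix f :: "('a \<Rightarrow> complex) \<times> ('b \<Rightarrow> complex)"
    show "0 \<le> Re (B f f)"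
      by (simp add: B_def L2_ip_self)
  qed
  define S where "S = (\<lambda>g. (g, D g)) ` V"
  have S: "S \<subseteq> H"
    using V_L2 D_L2 by (auto simp: S_def H_def)
  have S_ne: "S \<noteq> {}"
    using V_nonempty by (simp add: S_def)
  have S_cmb: "cmb c F d G \<in> S" if "F \<in> S" "G \<in> S" for F G c d
    using that by (auto simp: S_def cmb_def D_lincomb[symmetric] intro: V_lincomb)
  define x where "x = (h, \<lambda>_ :: 'b. 0 :: complex)"
  have x: "x \<in> H"
    using h by (simp add: x_def H_def L2_fun_def)
  obtain P where P: "\<And>n. P n \<in> S"
    and Cauchy: "\<And>e. 0 < e \<Longrightarrow> \<exists>N. \<forall>m\<ge>N. \<forall>n\<ge>N. H.q (cmb 1 (P m) (-1) (P n)) < e"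
    and orth: "\<And>p y. p \<in> H \<Longrightarrow> (\<lambda>n. H.q (cmb 1 (P n) (-1) p)) \<longlonglongrightarrow> 0 \<Longrightarrow> y \<in> S \<Longrightarrow>
      B (cmb 1 x (-1) p) y = 0"
    using H.projection_sequence[OF S S_ne S_cmb x] by blast
  define F where "F n = fst (P n)" for n
  have F: "F n \<in> V" "P n = (F n, D (F n))" for n
    using P[of n] by (auto simp: S_def F_def)
  have q_eq: "H.q (cmb 1 (f, k) (-1) (f', k')) = Re (L2_ip M (lincomb 1 f (-1) f') (lincomb 1 f (-1) f'))
      + Re (L2_ip M' (lincomb 1 k (-1) k') (lincomb 1 k (-1) k'))" for f f' k k'
    unfolding H.q_def by (simp add: B_def cmb_def)
  have nonneg: "0 \<le> Re (L2_ip M f f)" "0 \<le> Re (L2_ip M' k k)" for f k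
    by (simp_all add: L2_ip_self)
  have small: "a < e \<and> b < e" if "0 \<le> a" "0 \<le> b" "a + b < e" for a b e :: real
    using that by linarith
  have "\<exists>N. \<forall>m\<ge>N. \<forall>n\<ge>N. Re (L2_ip M (lincomb 1 (F m) (-1) (F n)) (lincomb 1 (F m) (-1) (F n))) < e"
    if "0 < e" for e
    using Cauchy[OF that] unfolding F(2) q_eq by (meson small nonneg)
  from L2_complete[OF V_L2[OF F(1)] this] obtain f where f: "f \<in> L2_fun M"
      "(\<lambda>n. Re (L2_ip M (lincomb 1 (F n) (-1) f) (lincomb 1 (F n) (-1) f))) \<longlonglongrightarrow> 0"
    by blast
  have "\<exists>N. \<forall>m\<ge>N. \<forall>n\<ge>N. Re (L2_ip M' (lincomb 1 (D (F m)) (-1) (D (F n))) (lincomb 1 (D (F m)) (-1) (D (F n)))) < e"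
    if "0 < e" for e
    using Cauchy[OF that] unfolding F(2) q_eq by (meson small nonneg)
  from L2_complete[OF D_L2[OF F(1)] this] obtain k where k: "k \<in> L2_fun M'"
      "(\<lambda>n. Re (L2_ip M' (lincomb 1 (D (F n)) (-1) k) (lincomb 1 (D (F n)) (-1) k))) \<longlonglongrightarrow> 0"
    by blast
  have fV: "f \<in> V" and kD: "AE x in M'. D f x = k x"
    using closed[OF F(1) f(1) k(1) f(2) k(2)] by blast+
  have lim: "(\<lambda>n. H.q (cmb 1 (P n) (-1) (f, k))) \<longlonglongrightarrow> 0"
    using tendsto_add[OF f(2) k(2)] unfolding F(2) q_eq by simp
  have "L2_ip M' (D f) (D g) = L2_ip M (lincomb 1 h (-1) f) g" if g: "g \<in> V" for g
  proof -
    \<comment> \<open>Orthogonality of (h - f, -k) to (g, D g) says <h - f, g> = <k, D g>, and k may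
      be replaced by \<open>D f\<close>.\<close>
    have "B (cmb 1 (h, \<lambda>_. 0) (-1) (f, k)) (g, D g) = 0"
      using f(1) k(1) g by (intro orth[unfolded x_def] lim) (auto simp: H_def S_def)
    moreover have "L2_ip M' k (D g) = L2_ip M' (D f) (D g)"
      using kD by (intro L2_ip_cong_AE k D_L2 g fV) (auto simp: eq_commute)
    moreover have "L2_ip M' (lincomb 1 (\<lambda>_. 0) (-1) k) (D g) = 0 - L2_ip M' k (D g)"
      using L2_ip_lincomb[of "\<lambda>_. 0" M' k "D g" 1 "-1"] k(1) D_L2[OF g] by (simp add: L2_fun_def L2_ip_def)
    ultimately show ?thesis
      by (simp add: B_def cmb_def)
  qed
  then have "weak_solution f (lincomb 1 h (-1) f)"
    using fV L2_fun_lincomb[OF h f(1), of 1 "-1"] by (simp add: weak_solution_def)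
  then show thesis
    by (rule that)
qed

text \<open>Both sides equal <D u, D f>.\<close>

lemma weak_sym:
  assumes "weak_solution f h" "weak_solution u v"
  shows "L2_ip M v f = L2_ip M u h"
proof -
  have "L2_ip M v f = L2_ip M' (D u) (D f)"
    using assms by (simp add: weakD)
  also have "\<dots> = cnj (L2_ip M h u)"
    using assms by (subst L2_ip_sym) (simp add: weakD)
  finally show ?thesis
    by (simp add: L2_ip_sym[of M u h])
qed

lemma weak_lincomb:
  assumes "weak_solution f h" "weak_solution f' h'"
  shows "weak_solution (lincomb c f d f') (lincomb c h d h')"
  unfolding weak_solution_def
proof (intro conjI ballI)
  show "lincomb c f d f' \<in> V" "lincomb c h d h' \<in> L2_fun M"
    using assms by (auto intro: V_lincomb L2_fun_lincomb weakD)
  fix g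
  assume "g \<in> V"
  then show "L2_ip M' (D (lincomb c f d f')) (D g) = L2_ip M (lincomb c h d h') g"
    using weakD[OF assms(1)] weakD[OF assms(2)]
    by (simp add: D_lincomb L2_ip_lincomb D_L2 V_L2)
qed

text \<open>\<open>D\<close> respects almost everywhere equality, so h - h' is orthogonal to all of
  \<open>V\<close>, and \<open>dense\<close> applies.\<close>

lemma weak_single_valued:
  assumes "weak_solution f h" "weak_solution f' h'" "AE x in M. f x = f' x"
  shows "AE x in M. h x = h' x"
proof -
  have "AE x in M'. D f x = D f' x"
    using V_cong_AE(2)[OF weakD(1)[OF assms(2)] weakD(2)[OF assms(1)] assms(3)] .
  then have "L2_ip M' (D f) (D g) = L2_ip M' (D f') (D g)" if "g \<in> V" for g
    using assms that by (intro L2_ip_cong_AE) (auto intro: weakD D_L2)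
  then have "L2_ip M (lincomb 1 h (-1) h') g = 0" if "g \<in> V" for g
    using weakD(5)[OF assms(1) that] weakD(5)[OF assms(2) that]
      L2_ip_lincomb[OF weakD(3)[OF assms(1)] weakD(3)[OF assms(2)] V_L2[OF that], of 1 "-1"] that by simp
  then have "AE x in M. 1 * h x + (-1) * h' x = 0"
    using assms by (intro dense L2_fun_lincomb) (auto intro: weakD)
  then show ?thesis
    by eventually_elim simp
qed

text \<open>Density of the domain of D^* D in orthogonal form. Solve (D^* D + 1) u = F and test with
  u itself: |D u|^2 + |u|^2 = <F, u> = 0. Once u and D u vanish, the equation says that F is
  orthogonal to \<open>V\<close>.\<close>

lemma weak_orth_eq_0:
  assumes F: "F \<in> L2_fun M" and orth: "\<And>u v. weak_solution u v \<Longrightarrow> L2_ip M F u = 0"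
  shows "AE x in M. F x = 0"
proof -
  obtain u where u: "weak_solution u (lincomb 1 F (-1) u)"
    using resolvent[OF F] .
  note uD = weakD[OF u]
  have "L2_ip M' (D u) (D u) = L2_ip M F u - L2_ip M u u"
    using uD(5)[OF uD(1)] L2_ip_lincomb[OF F uD(2) uD(2), of 1 "-1"] by simp
  then have sum: "Re (L2_ip M' (D u) (D u)) + Re (L2_ip M u u) = 0"
    using orth[OF u] by simp
  moreover have "0 \<le> Re (L2_ip M' (D u) (D u))" "0 \<le> Re (L2_ip M u u)"
    by (simp_all add: L2_ip_self)
  ultimately have "Re (L2_ip M' (D u) (D u)) = 0" "Re (L2_ip M u u) = 0"
    by linarith+
  then have ae: "AE x in M'. D u x = 0" "AE x in M. u x = 0"
    using L2_ip_self_eq_0[OF uD(4)] L2_ip_self_eq_0[OF uD(2)] by blast+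
  have "L2_ip M F g = 0" if g: "g \<in> V" for g
  proof -
    have "L2_ip M F g = L2_ip M' (D u) (D g) + L2_ip M u g"
      using uD(5)[OF g] L2_ip_lincomb[OF F uD(2) V_L2[OF g], of 1 "-1"] by simp
    also have "L2_ip M' (D u) (D g) = L2_ip M' (\<lambda>_. 0) (D g)"
      using ae uD D_L2[OF g] by (intro L2_ip_cong_AE) (auto simp: L2_fun_def)
    also have "L2_ip M u g = L2_ip M (\<lambda>_. 0) g"
      using ae uD V_L2[OF g] by (intro L2_ip_cong_AE) (auto simp: L2_fun_def)
    finally show ?thesis
      by (simp add: L2_ip_def)
  qed
  then show ?thesis
    by (rule dense[OF F])
qed

section \<open>The graph of D^* D: operator, dense domain, adjoint\<close>

lemma L2_operator_graph: "L2_operator M graph"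
  unfolding L2_operator_def
proof (intro conjI)
  show "graph \<subseteq> L2 M \<times> L2 M"
    by (auto simp: graph_def L2_def dest: weakD)
  have "(\<lambda>_. 0) \<in> L2_fun M"
    by (simp add: L2_fun_def)
  from resolvent[OF this] obtain u where "weak_solution u (lincomb 1 (\<lambda>_. 0) (-1) u)" .
  from graphI[OF this] show "graph \<noteq> {}"
    by (metis empty_iff)
  show "single_valued graph"
  proof (rule single_valuedI)
    fix X Y Z
    assume "(X, Y) \<in> graph" "(X, Z) \<in> graph"
    then obtain f h f' h' where w: "weak_solution f h" "weak_solution f' h'"
      and eq: "X = L2_class M f" "Y = L2_class M h" "X = L2_class M f'" "Z = L2_class M h'"
      unfolding graph_def by blast
    then have "AE x in M. f x = f' x"
      using L2_class_eq_iff weakD(2) by metis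
    with w have "AE x in M. h x = h' x"
      by (rule weak_single_valued)
    then show "Y = Z"
      using eq w L2_class_eq_iff weakD(3) by metis
  qed
  show "\<forall>(F, H)\<in>graph. \<forall>(F', H')\<in>graph. \<forall>c d. (L2_lincomb M c F d F', L2_lincomb M c H d H') \<in> graph"
    unfolding graph_def
    by (clarsimp simp: L2_lincomb_class weakD) (blast intro: weak_lincomb)
qed

text \<open>To pass from orthogonality to approximation, take a minimizing sequence in the domain:
  its limit p differs from x by a function orthogonal to the domain, hence only on a null
  set.\<close>

lemma L2_dense_graph: "L2_dense M (Domain graph)"
  unfolding L2_dense_def
proof (intro ballI allI impI)
  fix X and e :: real
  assume "X \<in> L2 M" "0 < e"
  then obtain x where x: "x \<in> L2_fun M" "X = L2_class M x"
    by (auto simp: L2_def)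
  interpret M: semi_inner_space "L2_fun M" lincomb "L2_ip M"
    by (rule L2_semi_inner_space)
  define S where "S = {u. \<exists>v. weak_solution u v}"
  have S: "S \<subseteq> L2_fun M"
    by (auto simp: S_def dest: weakD)
  have S_ne: "S \<noteq> {}"
    using resolvent[OF x(1)] unfolding S_def by blast
  have S_lincomb: "lincomb c f d g \<in> S" if "f \<in> S" "g \<in> S" for f g c d
    using that weak_lincomb[of f _ g _ c d] unfolding S_def by blast
  obtain P where P: "\<And>n. P n \<in> S"
    and Cauchy: "\<And>e. 0 < e \<Longrightarrow> \<exists>N. \<forall>m\<ge>N. \<forall>n\<ge>N. M.q (lincomb 1 (P m) (-1) (P n)) < e"
    and orth: "\<And>p y. p \<in> L2_fun M \<Longrightarrow> (\<lambda>n. M.q (lincomb 1 (P n) (-1) p)) \<longlonglongrightarrow> 0 \<Longrightarrow> y \<in> S \<Longrightarrow>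
      L2_ip M (lincomb 1 x (-1) p) y = 0"
    using M.projection_sequence[OF S S_ne S_lincomb x(1)] by blast
  have PL2: "P n \<in> L2_fun M" for n
    using P S by blast
  from L2_complete[OF PL2 Cauchy[unfolded M.q_def]]
  obtain p where p: "p \<in> L2_fun M" "(\<lambda>n. M.q (lincomb 1 (P n) (-1) p)) \<longlonglongrightarrow> 0"
    unfolding M.q_def by blast
  have "AE t in M. 1 * x t + (-1) * p t = 0"
    using x p by (intro weak_orth_eq_0 L2_fun_lincomb orth) (auto simp: S_def)
  then have ae: "AE t in M. x t = p t"
    by eventually_elim simp
  have "\<forall>\<^sub>F n in sequentially. M.q (lincomb 1 (P n) (-1) p) < e\<^sup>2"
    using order_tendstoD(2)[OF p(2)] \<open>0 < e\<close> by simp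
  then obtain n where n: "M.q (lincomb 1 (P n) (-1) p) < e\<^sup>2"
    by (auto simp: eventually_sequentially)
  let ?r = "lincomb 1 x (-1) (P n)"
  \<comment> \<open>The negative of P n - p has to be written as a \<open>lincomb\<close>; p with
    coefficient 0 fills the second place, and \<open>q_cmb\<close> evaluates the norm.\<close>
  have r: "?r \<in> L2_fun M" and r': "lincomb (-1) (lincomb 1 (P n) (-1) p) 0 p \<in> L2_fun M"
    by (intro L2_fun_lincomb x p PL2)+
  have "AE t in M. ?r t = (-1) * (1 * P n t + (-1) * p t) + 0 * p t"
    using ae by eventually_elim simp
  then have "L2_ip M ?r ?r
      = L2_ip M (lincomb (-1) (lincomb 1 (P n) (-1) p) 0 p) (lincomb (-1) (lincomb 1 (P n) (-1) p) 0 p)"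
    by (intro L2_ip_cong_AE r r')
  then have "Re (L2_ip M ?r ?r) = M.q (lincomb 1 (P n) (-1) p)"
    using M.q_cmb[OF L2_fun_lincomb[OF PL2[of n] p(1), of 1 "-1"] p(1), of "-1" 0]
    by (simp add: M.q_def)
  then have "sqrt (Re (L2_ip M ?r ?r)) < e"
    using n \<open>0 < e\<close> by (intro real_less_lsqrt) (auto simp: L2_ip_self)
  moreover have "L2_norm M (L2_lincomb M 1 X (-1) (L2_class M (P n))) = sqrt (Re (L2_ip M ?r ?r))"
    unfolding L2_norm_def x(2) L2_lincomb_class[OF x(1) PL2] L2_inner_class_ip[OF r r] ..
  ultimately have "L2_norm M (L2_lincomb M 1 X (-1) (L2_class M (P n))) < e"
    by simp
  moreover have "L2_class M (P n) \<in> Domain graph"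
    using P[of n] by (auto simp: S_def graph_def)
  ultimately show "\<exists>G\<in>Domain graph. L2_norm M (L2_lincomb M 1 X (-1) G) < e"
    by blast
qed

text \<open>Write T for D^* D. Given (f, h) in the adjoint, solve (T + 1) w = h + f and then (T + 1)
  u = d for d = w - f. Symmetry for w and the adjoint relation for f give <d, w> = <u, h + f> = <d,
  f>. Hence <d, d> = 0, and f = w almost everywhere.\<close>

lemma L2_adjoint_graph: "L2_adjoint M graph = graph"
proof
  show "graph \<subseteq> L2_adjoint M graph"
    unfolding L2_adjoint_def graph_def
    by (auto simp: L2_def L2_inner_class_ip weakD intro: weak_sym)
  show "L2_adjoint M graph \<subseteq> graph"
  proof
    fix z
    assume z: "z \<in> L2_adjoint M graph"
    then obtain f h where f: "f \<in> L2_fun M" and h: "h \<in> L2_fun M"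
      and zeq: "z = (L2_class M f, L2_class M h)"
      by (auto simp: L2_adjoint_def L2_def)
    have adj: "L2_ip M v f = L2_ip M u h" if uv: "weak_solution u v" for u v
    proof -
      have "(L2_class M u, L2_class M v) \<in> graph"
        using uv by (rule graphI)
      then have "L2_inner M (L2_class M v) (L2_class M f) = L2_inner M (L2_class M u) (L2_class M h)"
        using z by (auto simp: zeq L2_adjoint_def)
      then show ?thesis
        using weakD[OF uv] f h by (simp add: L2_inner_class_ip)
    qed
    interpret M: semi_inner_space "L2_fun M" lincomb "L2_ip M"
      by (rule L2_semi_inner_space)
    obtain w where w: "weak_solution w (lincomb 1 (lincomb 1 h 1 f) (-1) w)"
      using resolvent[OF L2_fun_lincomb[OF h f]] .
    let ?d = "lincomb 1 w (-1) f"
    have d: "?d \<in> L2_fun M"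
      using weakD(2)[OF w] f by (rule L2_fun_lincomb)
    obtain u where u: "weak_solution u (lincomb 1 ?d (-1) u)"
      using resolvent[OF d] .
    note wD = weakD[OF w] and uD = weakD[OF u]
    have "L2_ip M (lincomb 1 ?d (-1) u) w = L2_ip M u (lincomb 1 (lincomb 1 h 1 f) (-1) w)"
      by (rule weak_sym[OF w u])
    also have "\<dots> = L2_ip M u h + L2_ip M u f - L2_ip M u w"
      using M.B_right[OF L2_fun_lincomb[OF h f, of 1 1] wD(2) uD(2), of 1 "-1"]
        M.B_right[OF h f uD(2), of 1 1] by simp
    finally have "L2_ip M ?d w = L2_ip M u h + L2_ip M u f"
      using M.B_left[OF d uD(2) wD(2), of 1 "-1"] by simp
    moreover have "L2_ip M ?d f = L2_ip M u h + L2_ip M u f"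
      using adj[OF u] M.B_left[OF d uD(2) f, of 1 "-1"] by simp
    ultimately have "L2_ip M ?d ?d = 0"
      using M.B_right[OF wD(2) f d, of 1 "-1"] by simp
    then have "AE t in M. 1 * w t + (-1) * f t = 0"
      using L2_ip_self_eq_0[OF d] by simp
    then have ae: "AE t in M. f t = w t"
      by eventually_elim simp
    \<comment> \<open>Since f = w, the right-hand side h + f - w in the equation of w reduces to
      h.\<close>
    then have "AE t in M. h t = 1 * (1 * h t + 1 * f t) + (-1) * w t"
      by eventually_elim simp
    then show "z \<in> graph"
      unfolding zeq graph_def using ae w wD f h L2_class_eq_iff by blast
  qed
qed

theorem L2_self_adjoint_graph: "L2_self_adjoint M graph"
  unfolding L2_self_adjoint_def
  using L2_operator_graph L2_dense_graph L2_adjoint_graph by blast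

end

section \<open>Convolution with the truncated kernel\<close>

text \<open>A Lebesgue set is a Borel set up to part of a Borel null set, so the only danger is a
  null set with a large preimage. Functions that are merely Lebesgue measurable can be composed with
  such a \<open>T\<close>.\<close>

lemma measurable_lebesgue_null_vimage:
  fixes T :: "'a::euclidean_space \<Rightarrow> 'b::euclidean_space"
  assumes T: "T \<in> borel_measurable borel"
    and null: "\<And>N. N \<in> null_sets lborel \<Longrightarrow> T -` N \<in> null_sets lborel"
  shows "T \<in> lebesgue \<rightarrow>\<^sub>M lebesgue"
proof (rule completion.measurable_completion2)
  have *: "T \<in> lborel \<rightarrow>\<^sub>M lborel"
    using T by simp
  then show TL: "T \<in> lebesgue \<rightarrow>\<^sub>M lborel"
    by (rule measurable_completion)
  show "null_sets lborel \<subseteq> null_sets (distr lebesgue lborel T)"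
  proof
    fix N :: "'b set"
    assume N: "N \<in> null_sets lborel"
    then have "T -` N \<in> null_sets lebesgue"
      by (intro null_sets_completionI null)
    then show "N \<in> null_sets (distr lebesgue lborel T)"
      using N TL by (simp add: null_sets_def emeasure_distr)
  qed
qed

lemma null_sets_fst_vimage:
  assumes "N \<in> null_sets (lborel :: 'a::euclidean_space measure)"
  shows "(fst :: 'a \<times> 'b::euclidean_space \<Rightarrow> 'a) -` N \<in> null_sets lborel"
proof -
  have "fst -` N = N \<times> (UNIV :: 'b set)"
    by auto
  moreover have "N \<times> UNIV \<in> null_sets (lborel \<Otimes>\<^sub>M (lborel :: 'b measure))"
    using assms by (intro null_setsI) (auto simp: lborel.emeasure_pair_measure_Times null_sets_def)
  ultimately show ?thesis
    by (simp add: lborel_prod)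
qed

lemma null_sets_snd_vimage:
  assumes "N \<in> null_sets (lborel :: 'b::euclidean_space measure)"
  shows "(snd :: 'a::euclidean_space \<times> 'b \<Rightarrow> 'b) -` N \<in> null_sets lborel"
proof -
  have "snd -` N = (UNIV :: 'a set) \<times> N"
    by auto
  moreover have "UNIV \<times> N \<in> null_sets ((lborel :: 'a measure) \<Otimes>\<^sub>M lborel)"
    using assms by (intro null_setsI) (auto simp: lborel.emeasure_pair_measure_Times null_sets_def)
  ultimately show ?thesis
    by (simp add: lborel_prod)
qed

text \<open>Slicing: for fixed y the x-slice of the preimage is 2 N - y, an affine image of a null
  set.\<close>

lemma null_sets_midpoint_vimage:
  assumes N: "N \<in> null_sets (lborel :: 'a::euclidean_space measure)"
  shows "(\<lambda>(x, y). (x + y) /\<^sub>R 2) -` N \<in> null_sets (lborel :: ('a \<times> 'a) measure)"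
proof -
  let ?T = "\<lambda>(x, y). (x + y) /\<^sub>R 2 :: 'a"
  have T: "?T \<in> borel_measurable (lborel \<Otimes>\<^sub>M lborel)"
    by measurable
  have meas: "?T -` N \<in> sets (lborel \<Otimes>\<^sub>M lborel)"
    using measurable_sets[OF T, of N] N by (simp add: null_sets_def space_pair_measure)
  have "emeasure lborel ((\<lambda>x. (x, y)) -` (?T -` N)) = 0" for y
  proof -
    have "(\<lambda>x. (x, y)) -` (?T -` N) = (\<lambda>z. 2 *\<^sub>R z + - y) ` N"
    proof (intro equalityI subsetI)
      fix x
      assume "x \<in> (\<lambda>x. (x, y)) -` (?T -` N)"
      then have "x = 2 *\<^sub>R ((x + y) /\<^sub>R 2) + - y" "(x + y) /\<^sub>R 2 \<in> N"
        by auto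
      then show "x \<in> (\<lambda>z. 2 *\<^sub>R z + - y) ` N"
        by blast
    qed auto
    moreover have "emeasure lebesgue N = 0"
      using N by (simp add: null_sets_def)
    ultimately have "emeasure lebesgue ((\<lambda>x. (x, y)) -` (?T -` N)) = 0"
      using emeasure_lebesgue_affine[of 2 "- y" N] by simp
    then show ?thesis
      using sets_Pair2[OF meas, of y] by simp
  qed
  then have "emeasure (lborel \<Otimes>\<^sub>M lborel) (?T -` N) = 0"
    unfolding lborel_pair.emeasure_pair_measure_alt2[OF meas] by simp
  then show ?thesis
    using meas unfolding lborel_prod by (rule null_setsI)
qed

lemma AE_lebesgue_on_vimage:
  fixes T :: "'a::euclidean_space \<Rightarrow> 'b::euclidean_space"
  assumes null: "\<And>N. N \<in> null_sets lborel \<Longrightarrow> T -` N \<in> null_sets lborel"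
    and X: "X \<in> sets lebesgue" and Y: "Y \<in> sets lebesgue" and XY: "T ` X \<subseteq> Y"
    and P: "AE y in lebesgue_on Y. P y"
  shows "AE x in lebesgue_on X. P (T x)"
proof -
  have "AE y in lborel. y \<in> Y \<longrightarrow> P y"
    using P Y by (simp add: AE_restrict_space_iff AE_completion_iff)
  then obtain N where N: "{y. \<not> (y \<in> Y \<longrightarrow> P y)} \<subseteq> N" "N \<in> null_sets lborel"
    by (auto elim!: AE_E simp: null_sets_def)
  have "AE x in lborel. x \<in> X \<longrightarrow> P (T x)"
    using N(1) XY by (intro AE_I'[OF null[OF N(2)]]) auto
  then show ?thesis
    using X by (simp add: AE_restrict_space_iff AE_completion_iff)
qed

section \<open>Tonelli's theorem for Lebesgue measurable integrands\<close>

lemma nn_integral_lborel_diff: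
  fixes k :: "'a::euclidean_space \<Rightarrow> ennreal"
  assumes [measurable]: "k \<in> borel_measurable borel"
  shows "(\<integral>\<^sup>+x. k (x - y) \<partial>lborel) = (\<integral>\<^sup>+z. k z \<partial>lborel)"
    and "(\<integral>\<^sup>+y. k (x - y) \<partial>lborel) = (\<integral>\<^sup>+z. k z \<partial>lborel)"
proof -
  have "(\<integral>\<^sup>+z. k z \<partial>distr lborel borel ((+) (- y))) = (\<integral>\<^sup>+x. k (- y + x) \<partial>lborel)"
    by (rule nn_integral_distr) auto
  then show "(\<integral>\<^sup>+x. k (x - y) \<partial>lborel) = (\<integral>\<^sup>+z. k z \<partial>lborel)"
    by (simp add: lborel_distr_plus)
  have "(lborel :: 'a measure) = distr lborel borel (\<lambda>y. x - y)"
    using lborel_affine[of "-1" x] by (simp add: density_1)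
  then have "(\<integral>\<^sup>+z. k z \<partial>lborel) = (\<integral>\<^sup>+z. k z \<partial>distr lborel borel (\<lambda>y. x - y))"
    by simp
  also have "\<dots> = (\<integral>\<^sup>+y. k (x - y) \<partial>lborel)"
    by (rule nn_integral_distr) auto
  finally show "(\<integral>\<^sup>+y. k (x - y) \<partial>lborel) = (\<integral>\<^sup>+z. k z \<partial>lborel)" ..
qed

text \<open>Prepares Tonelli's theorem on \<open>lborel\<close>: extending f by 0 and changing it on
  a null set makes it Borel and keeps the integral.\<close>

lemma borel_representative:
  fixes f :: "'a::euclidean_space \<Rightarrow> real"
  assumes \<Omega>: "\<Omega> \<in> sets lebesgue" and f: "f \<in> borel_measurable (lebesgue_on \<Omega>)"
  obtains g :: "'a \<Rightarrow> ennreal" where "g \<in> borel_measurable borel"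
    "AE x in lebesgue_on \<Omega>. ennreal (f x) = g x"
    "(\<integral>\<^sup>+x. g x \<partial>lborel) = (\<integral>\<^sup>+x. ennreal (f x) \<partial>lebesgue_on \<Omega>)"
proof -
  have "(\<lambda>x. if x \<in> \<Omega> then f x else 0) \<in> borel_measurable lebesgue"
    by (rule borel_measurable_if_I[OF f \<Omega>])
  then have "(\<lambda>x. ennreal (if x \<in> \<Omega> then f x else 0)) \<in> borel_measurable lebesgue"
    by measurable
  from completion_ex_borel_measurable[OF this]
  obtain g :: "'a \<Rightarrow> ennreal" where g: "g \<in> borel_measurable borel"
    and eq: "AE x in lborel. ennreal (if x \<in> \<Omega> then f x else 0) = g x"
    by auto
  have "AE x in lborel. x \<in> \<Omega> \<longrightarrow> ennreal (f x) = g x"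
    using eq by eventually_elim auto
  then have "AE x in lebesgue_on \<Omega>. ennreal (f x) = g x"
    using \<Omega> by (simp add: AE_restrict_space_iff AE_completion_iff)
  moreover have "(\<integral>\<^sup>+x. g x \<partial>lborel) = (\<integral>\<^sup>+x. ennreal (f x) \<partial>lebesgue_on \<Omega>)"
  proof -
    have "(\<integral>\<^sup>+x. ennreal (f x) \<partial>lebesgue_on \<Omega>) = (\<integral>\<^sup>+x. ennreal (f x) * indicator \<Omega> x \<partial>lebesgue)"
      using \<Omega> by (simp add: nn_integral_restrict_space)
    also have "\<dots> = (\<integral>\<^sup>+x. ennreal (f x) * indicator \<Omega> x \<partial>lborel)"
      by (rule nn_integral_completion)
    also have "\<dots> = (\<integral>\<^sup>+x. g x \<partial>lborel)"
      by (intro nn_integral_cong_AE) (use eq in \<open>eventually_elim, auto simp: indicator_def split: if_splits\<close>)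
    finally show ?thesis ..
  qed
  ultimately show thesis
    using g that by blast
qed

lemma nn_integral_lebesgue_on_mono:
  assumes X: "X \<in> sets lebesgue" and le: "AE x in lebesgue_on X. f x \<le> g x"
  shows "(\<integral>\<^sup>+x. f x \<partial>lebesgue_on X) \<le> (\<integral>\<^sup>+x. g x \<partial>lborel)"
proof -
  have "AE x in lborel. x \<in> X \<longrightarrow> f x \<le> g x"
    using le X by (simp add: AE_restrict_space_iff AE_completion_iff)
  then have ae: "AE x in lborel. f x * indicator X x \<le> g x"
    by eventually_elim (auto simp: indicator_def)
  have "(\<integral>\<^sup>+x. f x \<partial>lebesgue_on X) = (\<integral>\<^sup>+x. f x * indicator X x \<partial>lborel)"
    using X by (simp add: nn_integral_restrict_space nn_integral_completion)
  also have "\<dots> \<le> (\<integral>\<^sup>+x. g x \<partial>lborel)"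
    by (rule nn_integral_mono_AE[OF ae])
  finally show ?thesis .
qed

text \<open>Young's inequality for two L^1 factors: integrate the kernel first, over the variable on
  which f does not depend, and use invariance under translation and reflection.\<close>

lemma nn_integral_convolution_bound:
  fixes f :: "'a::euclidean_space \<Rightarrow> real" and k :: "'a \<Rightarrow> ennreal"
  assumes \<Omega>: "open \<Omega>" and f: "f \<in> borel_measurable (lebesgue_on \<Omega>)"
    and k [measurable]: "k \<in> borel_measurable borel"
  shows "(\<integral>\<^sup>+(x, y). ennreal (f x) * k (x - y) \<partial>lebesgue_on (\<Omega> \<times> \<Omega>))
      \<le> (\<integral>\<^sup>+x. ennreal (f x) \<partial>lebesgue_on \<Omega>) * (\<integral>\<^sup>+z. k z \<partial>lborel)"
    and "(\<integral>\<^sup>+(x, y). ennreal (f y) * k (x - y) \<partial>lebesgue_on (\<Omega> \<times> \<Omega>))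
      \<le> (\<integral>\<^sup>+x. ennreal (f x) \<partial>lebesgue_on \<Omega>) * (\<integral>\<^sup>+z. k z \<partial>lborel)"
proof -
  have \<Omega>L: "\<Omega> \<in> sets lebesgue" "\<Omega> \<times> \<Omega> \<in> sets lebesgue"
    using \<Omega> open_Times[OF \<Omega> \<Omega>] by auto
  obtain g where g [measurable]: "g \<in> borel_measurable borel"
    and eq: "AE x in lebesgue_on \<Omega>. ennreal (f x) = g x"
    and int: "(\<integral>\<^sup>+x. g x \<partial>lborel) = (\<integral>\<^sup>+x. ennreal (f x) \<partial>lebesgue_on \<Omega>)"
    using borel_representative[OF \<Omega>L(1) f] by blast
  have "AE z in lebesgue_on (\<Omega> \<times> \<Omega>). ennreal (f (fst z)) = g (fst z)"
    by (rule AE_lebesgue_on_vimage[OF null_sets_fst_vimage \<Omega>L(2,1) _ eq]) auto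
  then have "(\<integral>\<^sup>+(x, y). ennreal (f x) * k (x - y) \<partial>lebesgue_on (\<Omega> \<times> \<Omega>)) \<le> (\<integral>\<^sup>+(x, y). g x * k (x - y) \<partial>lborel)"
    by (intro nn_integral_lebesgue_on_mono[OF \<Omega>L(2)]) (auto elim!: eventually_mono)
  also have "\<dots> = (\<integral>\<^sup>+x. \<integral>\<^sup>+y. g x * k (x - y) \<partial>lborel \<partial>lborel)"
    unfolding lborel_prod[symmetric] by (subst lborel.nn_integral_fst[symmetric]) auto
  also have "\<dots> = (\<integral>\<^sup>+x. g x \<partial>lborel) * (\<integral>\<^sup>+z. k z \<partial>lborel)"
    by (simp add: nn_integral_cmult nn_integral_multc nn_integral_lborel_diff)
  finally show "(\<integral>\<^sup>+(x, y). ennreal (f x) * k (x - y) \<partial>lebesgue_on (\<Omega> \<times> \<Omega>))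
      \<le> (\<integral>\<^sup>+x. ennreal (f x) \<partial>lebesgue_on \<Omega>) * (\<integral>\<^sup>+z. k z \<partial>lborel)"
    by (simp add: int)
  have "AE z in lebesgue_on (\<Omega> \<times> \<Omega>). ennreal (f (snd z)) = g (snd z)"
    by (rule AE_lebesgue_on_vimage[OF null_sets_snd_vimage \<Omega>L(2,1) _ eq]) auto
  then have "(\<integral>\<^sup>+(x, y). ennreal (f y) * k (x - y) \<partial>lebesgue_on (\<Omega> \<times> \<Omega>)) \<le> (\<integral>\<^sup>+(x, y). g y * k (x - y) \<partial>lborel)"
    by (intro nn_integral_lebesgue_on_mono[OF \<Omega>L(2)]) (auto elim!: eventually_mono)
  also have "\<dots> = (\<integral>\<^sup>+y. \<integral>\<^sup>+x. g y * k (x - y) \<partial>lborel \<partial>lborel)"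
    unfolding lborel_prod[symmetric] by (subst lborel_pair.nn_integral_snd[symmetric]) auto
  also have "\<dots> = (\<integral>\<^sup>+x. g x \<partial>lborel) * (\<integral>\<^sup>+z. k z \<partial>lborel)"
    by (simp add: nn_integral_cmult nn_integral_multc nn_integral_lborel_diff)
  finally show "(\<integral>\<^sup>+(x, y). ennreal (f y) * k (x - y) \<partial>lebesgue_on (\<Omega> \<times> \<Omega>))
      \<le> (\<integral>\<^sup>+x. ennreal (f x) \<partial>lebesgue_on \<Omega>) * (\<integral>\<^sup>+z. k z \<partial>lborel)"
    by (simp add: int)
qed

text \<open>The numerator removes two powers of the singularity at 0 and is 1 far away. Up to a
  constant it bounds both the squared phase difference |1 - e^(i theta)|^2 and the squared
  increments of bounded Lipschitz functions.\<close>

definition truncated_kernel :: "real \<Rightarrow> 'a::euclidean_space \<Rightarrow> real" where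
  "truncated_kernel s z = min 1 ((norm z)\<^sup>2) / norm z powr (real DIM('a) + 2 * s)"

lemma truncated_kernel_measurable [measurable]: "truncated_kernel s \<in> borel_measurable borel"
  unfolding truncated_kernel_def by measurable

text \<open>On the shells 2^n \<le> |z| < 2^(n+1) and 2^-(n+1) \<le> |z| < 2^-n each factor of the
  kernel is bounded by its value at one end. Every shell is then enlarged to its outer ball: this
  costs a constant factor, and ball volumes are explicit, so polar coordinates are avoided.\<close>

lemma truncated_kernel_dyadic_bound:
  fixes z :: "'a::euclidean_space"
  assumes s: "0 < s"
  defines "p \<equiv> real DIM('a) + 2 * s"
  shows "ennreal (truncated_kernel s z)
    \<le> (\<Sum>n. ennreal (((2::real) ^ n) powr - p) * indicator (ball 0 (2 ^ Suc n)) z)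
      + (\<Sum>n. ennreal (((1/2) ^ n)\<^sup>2 * ((1/2::real) ^ Suc n) powr - p) * indicator (ball 0 ((1/2) ^ n)) z)"
    (is "_ \<le> suminf ?a + suminf ?b")
proof -
  have p: "0 < p"
    using s by (simp add: p_def)
  have summand: "?a n \<le> suminf ?a + suminf ?b" "?b n \<le> suminf ?a + suminf ?b" for n
  proof -
    have "f n \<le> suminf f" for f :: "nat \<Rightarrow> ennreal"
      using sum_le_suminf[of f "{n}"] by (simp add: summableI)
    then show "?a n \<le> suminf ?a + suminf ?b" "?b n \<le> suminf ?a + suminf ?b"
      by (intro add_increasing2 add_increasing zero_le; assumption)+
  qed
  consider "z = 0" | "0 < norm z" "norm z < 1" | "1 \<le> norm z"
    by fastforce
  then show ?thesis
  proof cases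
    case 1
    then show ?thesis
      by (simp add: truncated_kernel_def)
  next
    case 2
    \<comment> \<open>The least exponent locates the shell; it is a successor because |z| <
      1.\<close>
    define m where "m = (LEAST m. (1/2) ^ m \<le> norm z)"
    obtain m0 :: nat where "(1/2) ^ m0 < norm z"
      using real_arch_pow_inv[of "norm z" "1/2"] 2 by auto
    then have m: "(1/2) ^ m \<le> norm z"
      unfolding m_def by (intro LeastI[where P = "\<lambda>m. (1/2) ^ m \<le> norm z" and k = m0]) auto
    then obtain n where n: "m = Suc n"
      using 2 by (cases m) auto
    have n': "norm z < (1/2) ^ n"
      using not_less_Least[of n "\<lambda>m. (1/2) ^ m \<le> norm z"] n unfolding m_def by auto
    have "truncated_kernel s z = (norm z)\<^sup>2 * norm z powr - p"
      using 2 by (simp add: truncated_kernel_def p_def[symmetric] powr_minus divide_inverse min_absorb2 power_le_one)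
    also have "\<dots> \<le> ((1/2) ^ n)\<^sup>2 * ((1/2) ^ Suc n) powr - p"
      using m n n' p by (intro mult_mono power_mono powr_mono2') auto
    finally have "ennreal (truncated_kernel s z) \<le> ?b n"
      using n' by (simp add: ennreal_leI)
    then show ?thesis
      using summand(2)[of n] by (rule order_trans)
  next
    case 3
    define m where "m = (LEAST m. norm z < 2 ^ m)"
    obtain m0 :: nat where "norm z < 2 ^ m0"
      using real_arch_pow[of 2 "norm z"] by auto
    then have m: "norm z < 2 ^ m"
      unfolding m_def by (rule LeastI)
    then obtain n where n: "m = Suc n"
      using 3 by (cases m) auto
    have n': "2 ^ n \<le> norm z"
      using not_less_Least[of n "\<lambda>m. norm z < 2 ^ m"] n unfolding m_def by auto
    have "truncated_kernel s z \<le> norm z powr - p"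
      by (simp add: truncated_kernel_def p_def[symmetric] powr_minus divide_inverse mult_left_le_one_le)
    also have "\<dots> \<le> (2 ^ n) powr - p"
      using n' p by (intro powr_mono2') auto
    finally have "ennreal (truncated_kernel s z) \<le> ?a n"
      using m n by (simp add: ennreal_leI)
    then show ?thesis
      using summand(1)[of n] by (rule order_trans)
  qed
qed

text \<open>Ball volumes scale like r^N, which cancels the N in the exponent and leaves geometric
  series of ratios 2^(-2s) and 2^-(2-2s): 0 < s is convergence at infinity, s < 1 convergence at the
  origin.\<close>

lemma nn_integral_truncated_kernel:
  assumes s: "0 < s" "s < 1"
  shows "(\<integral>\<^sup>+z. ennreal (truncated_kernel s (z :: 'a::euclidean_space)) \<partial>lborel) < \<infinity>"
proof -
  let ?N = "DIM('a)"
  define p where "p = real ?N + 2 * s"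
  define v where "v = unit_ball_vol (real ?N)"
  have v: "0 \<le> v"
    by (simp add: v_def)
  let ?a = "\<lambda>n (z::'a). ennreal (((2::real) ^ n) powr - p) * indicator (ball 0 (2 ^ Suc n)) z"
  let ?b = "\<lambda>n (z::'a). ennreal (((1/2) ^ n)\<^sup>2 * ((1/2::real) ^ Suc n) powr - p) * indicator (ball 0 ((1/2) ^ n)) z"
  have geometric: "(\<Sum>n. ennreal (c * r ^ n)) < \<infinity>" if "0 \<le> c" "0 \<le> r" "r < 1" for c r :: real
    using that by (subst suminf_ennreal2) (auto intro!: summable_mult summable_geometric)
  have ball: "emeasure lborel (ball (0::'a) r) = ennreal (v * r ^ ?N)" if "0 \<le> r" for r
    using that by (simp add: emeasure_ball v_def)
  have a: "(\<integral>\<^sup>+z. ?a n z \<partial>lborel) = ennreal ((v * 2 ^ ?N) * (2 powr (- 2 * s)) ^ n)" for n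
  proof -
    have "(\<integral>\<^sup>+z. ?a n z \<partial>lborel) = ennreal ((2 ^ n) powr - p) * ennreal (v * (2 ^ Suc n) ^ ?N)"
      by (simp add: nn_integral_cmult_indicator ball del: power_Suc)
    also have "\<dots> = ennreal ((2 ^ n) powr - p * (v * (2 ^ Suc n) ^ ?N))"
      by (simp add: ennreal_mult v)
    also have "(2 ^ n) powr - p * (v * (2 ^ Suc n) ^ ?N) = (v * 2 ^ ?N) * ((2 ^ n) powr - p * (2 ^ n) powr real ?N)"
      by (simp add: powr_realpow power_mult_distrib)
    also have "(2 ^ n) powr - p * (2 ^ n) powr real ?N = ((2::real) ^ n) powr (- 2 * s)"
      unfolding powr_add[symmetric] by (simp add: p_def)
    also have "\<dots> = (2 powr (- 2 * s)) ^ n"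
      by (simp add: powr_realpow[symmetric] powr_powr mult.commute)
    finally show ?thesis .
  qed
  have b: "(\<integral>\<^sup>+z. ?b n z \<partial>lborel) = ennreal ((v * 2 powr p) * ((1/2) powr (2 - 2 * s)) ^ n)" for n
  proof -
    define t :: real where "t = (1/2) ^ n"
    have t: "0 < t"
      by (simp add: t_def)
    have "(\<integral>\<^sup>+z. ?b n z \<partial>lborel) = ennreal (t\<^sup>2 * (t / 2) powr - p) * ennreal (v * t ^ ?N)"
      using t by (simp add: nn_integral_cmult_indicator ball t_def[symmetric])
    also have "\<dots> = ennreal (t\<^sup>2 * (t / 2) powr - p * (v * t ^ ?N))"
      using t by (simp add: ennreal_mult v)
    also have "t\<^sup>2 * (t / 2) powr - p * (v * t ^ ?N) = (v * 2 powr p) * (t powr 2 * t powr - p * t powr real ?N)"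
    proof -
      have "(t / 2) powr - p = t powr - p * 2 powr p"
        using t by (subst powr_divide) (auto simp: powr_minus divide_inverse)
      then show ?thesis
        using t by (simp add: powr_realpow mult_ac)
    qed
    also have "t powr 2 * t powr - p * t powr real ?N = t powr (2 - 2 * s)"
      unfolding powr_add[symmetric] by (simp add: p_def)
    also have "\<dots> = ((1/2) powr (2 - 2 * s)) ^ n"
      unfolding t_def by (simp add: powr_realpow[symmetric] powr_powr mult.commute)
    finally show ?thesis .
  qed
  have "(\<integral>\<^sup>+z. ennreal (truncated_kernel s (z :: 'a)) \<partial>lborel) \<le> (\<integral>\<^sup>+z. (\<Sum>n. ?a n z) + (\<Sum>n. ?b n z) \<partial>lborel)"
    unfolding p_def by (intro nn_integral_mono truncated_kernel_dyadic_bound s)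
  also have "\<dots> = (\<Sum>n. \<integral>\<^sup>+z. ?a n z \<partial>lborel) + (\<Sum>n. \<integral>\<^sup>+z. ?b n z \<partial>lborel)"
  proof -
    have meas: "?a n \<in> borel_measurable lborel" "?b n \<in> borel_measurable lborel" for n
      by (intro borel_measurable_times_ennreal borel_measurable_const borel_measurable_indicator; simp)+
    show ?thesis
      by (subst nn_integral_add[OF borel_measurable_suminf_order[OF meas(1)] borel_measurable_suminf_order[OF meas(2)]])
        (simp only: nn_integral_suminf meas)
  qed
  also have "\<dots> < \<infinity>"
    unfolding a b infinity_ennreal_def ennreal_add_less_top using s v
    by (intro conjI geometric[unfolded infinity_ennreal_def]) (auto intro: powr_less_one simp: powr01_less_one)
  finally show ?thesis .
qed

section \<open>The magnetic difference quotient\<close>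

definition magnetic_quotient ::
    "real \<Rightarrow> ('a::euclidean_space \<Rightarrow> 'a) \<Rightarrow> ('a \<Rightarrow> complex) \<Rightarrow> 'a \<times> 'a \<Rightarrow> complex" where
  "magnetic_quotient s A f z = magnetic_diff A f (fst z) (snd z)
     / of_real (norm (fst z - snd z) powr ((real DIM('a) + 2 * s) / 2))"

lemma powr_half_square: "((x::real) powr (p / 2))\<^sup>2 = x powr p"
  by (simp add: power2_eq_square powr_add[symmetric])

lemma magnetic_form_eq_ip:
  "magnetic_form s A \<Omega> f g = L2_ip (lebesgue_on (\<Omega> \<times> \<Omega>)) (magnetic_quotient s A f) (magnetic_quotient s A g)"
  for f :: "'a::euclidean_space \<Rightarrow> complex"
proof -
  have "a / complex_of_real (x powr (p / 2)) * cnj (b / complex_of_real (x powr (p / 2)))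
      = a * cnj b / complex_of_real (x powr p)" for a b x p
    unfolding powr_half_square[of x p, symmetric] by (simp add: power2_eq_square)
  then show ?thesis
    unfolding magnetic_form_def L2_ip_def magnetic_quotient_def case_prod_beta by (simp only:)
qed

lemma cmod_magnetic_quotient_sq:
  "(cmod (magnetic_quotient s A f z))\<^sup>2 = (cmod (magnetic_diff A f (fst z) (snd z)))\<^sup>2
     / norm (fst z - snd z) powr (real DIM('a) + 2 * s)"
  for f :: "'a::euclidean_space \<Rightarrow> complex"
  unfolding magnetic_quotient_def norm_divide power_divide norm_of_real
  by (simp add: powr_half_square)

lemma magnetic_seminorm_sq_eq:
  "magnetic_seminorm_sq s A \<Omega> f =
     (\<integral>\<^sup>+z. ennreal ((cmod (magnetic_quotient s A f z))\<^sup>2) \<partial>lebesgue_on (\<Omega> \<times> \<Omega>))"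
  for f :: "'a::euclidean_space \<Rightarrow> complex"
  unfolding magnetic_seminorm_sq_def cmod_magnetic_quotient_sq case_prod_beta ..

lemma magnetic_quotient_lincomb:
  "magnetic_quotient s A (lincomb c f d g) = lincomb c (magnetic_quotient s A f) d (magnetic_quotient s A g)"
  by (rule ext) (simp add: magnetic_quotient_def magnetic_diff_def algebra_simps add_divide_distrib diff_divide_distrib)

section \<open>Measurability of the difference quotient\<close>

lemma open_lebesgue_on_sets:
  assumes "open \<Omega>"
  shows "\<Omega> \<in> sets lebesgue" "\<Omega> \<times> \<Omega> \<in> sets lebesgue"
  using assms open_Times[OF assms assms] by auto

lemma measurable_lebesgue_on_fst_snd:
  "fst \<in> lebesgue_on (\<Omega> \<times> \<Omega>) \<rightarrow>\<^sub>M lebesgue_on (\<Omega> :: 'a::euclidean_space set)"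
  "snd \<in> lebesgue_on (\<Omega> \<times> \<Omega>) \<rightarrow>\<^sub>M lebesgue_on (\<Omega> :: 'a::euclidean_space set)"
  by (intro measurable_restrict_space3 measurable_lebesgue_null_vimage null_sets_fst_vimage
      null_sets_snd_vimage borel_measurable_continuous_onI continuous_intros; force)+

lemma measurable_lebesgue_on_midpoint:
  "(\<lambda>z. (fst z + snd z) /\<^sub>R 2) \<in> lebesgue_on (\<Omega> \<times> \<Omega>) \<rightarrow>\<^sub>M lebesgue_on (convex hull \<Omega>)"
  for \<Omega> :: "'a::euclidean_space set"
proof (intro measurable_restrict_space3 measurable_lebesgue_null_vimage)
  show "(\<lambda>z. (fst z + snd z) /\<^sub>R 2 :: 'a) \<in> borel_measurable borel"
    by (intro borel_measurable_continuous_onI continuous_intros)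
  show "(\<lambda>z. (fst z + snd z) /\<^sub>R 2) -` N \<in> null_sets lborel" if "N \<in> null_sets lborel" for N :: "'a set"
    using null_sets_midpoint_vimage[OF that] by (simp only: case_prod_beta')
  show "(\<lambda>z. (fst z + snd z) /\<^sub>R 2) \<in> \<Omega> \<times> \<Omega> \<rightarrow> convex hull \<Omega>"
  proof safe
    fix x y
    assume "x \<in> \<Omega>" "y \<in> \<Omega>"
    then have "(1/2) *\<^sub>R x + (1/2) *\<^sub>R y \<in> convex hull \<Omega>"
      by (intro convexD convex_convex_hull hull_inc) auto
    then show "(fst (x, y) + snd (x, y)) /\<^sub>R 2 \<in> convex hull \<Omega>"
      by (simp add: scaleR_add_right)
  qed
qed

lemma magnetic_quotient_measurable:
  fixes A :: "'a::euclidean_space \<Rightarrow> 'a"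
  assumes A: "A \<in> borel_measurable (lebesgue_on (convex hull \<Omega>))"
    and f: "f \<in> borel_measurable (lebesgue_on \<Omega>)"
  shows "magnetic_quotient s A f \<in> borel_measurable (lebesgue_on (\<Omega> \<times> \<Omega>))"
proof -
  have [measurable]: "(\<lambda>z. f (fst z)) \<in> borel_measurable (lebesgue_on (\<Omega> \<times> \<Omega>))"
      "(\<lambda>z. f (snd z)) \<in> borel_measurable (lebesgue_on (\<Omega> \<times> \<Omega>))"
      "(\<lambda>z. A ((fst z + snd z) /\<^sub>R 2)) \<in> borel_measurable (lebesgue_on (\<Omega> \<times> \<Omega>))"
    using measurable_compose[OF measurable_lebesgue_on_fst_snd(1) f]
      measurable_compose[OF measurable_lebesgue_on_fst_snd(2) f]
      measurable_compose[OF measurable_lebesgue_on_midpoint A] by simp_all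
  have diff [measurable]: "(\<lambda>z. fst z - snd z :: 'a) \<in> borel_measurable (lebesgue_on (\<Omega> \<times> \<Omega>))"
    by (intro measurable_restrict_space1 measurable_completion)
      (auto intro!: borel_measurable_continuous_onI continuous_intros)
  have [measurable]: "(exp :: complex \<Rightarrow> complex) \<in> borel_measurable borel"
    by (intro borel_measurable_continuous_onI continuous_intros)
  show ?thesis
    unfolding magnetic_quotient_def magnetic_diff_def by measurable
qed

section \<open>Independence of the domain from the magnetic field, and closedness\<close>

lemma truncated_kernel_nonneg: "0 \<le> truncated_kernel s z"
  by (simp add: truncated_kernel_def)

text \<open>|1 - e^(it)| = 2 |sin (t/2)| is at most 2 and at most |t|. The squares are at most 4 and
  K^2 r^2, whence the constant. In the application r = |x - y| and K bounds |A|.\<close>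

lemma cmod_one_minus_exp_sq_le:
  assumes "\<bar>t\<bar> \<le> r * K" "0 \<le> r" "0 \<le> K"
  shows "(cmod (1 - exp (\<i> * of_real t)))\<^sup>2 \<le> max 4 (K\<^sup>2) * min 1 (r\<^sup>2)"
proof -
  define e where "e = cmod (1 - exp (\<i> * of_real t))"
  have e: "e = 2 * \<bar>sin (t / 2)\<bar>"
    unfolding e_def by (subst norm_minus_commute) (rule dist_exp_i_1)
  then have "e \<le> 2" "e \<le> \<bar>t\<bar>" "0 \<le> e"
    using abs_sin_le_one[of "t / 2"] abs_sin_x_le_abs_x[of "t / 2"] by auto
  then have "e\<^sup>2 \<le> 2\<^sup>2" "e\<^sup>2 \<le> (r * K)\<^sup>2"
    using assms by (intro power_mono; linarith)+
  moreover have "K\<^sup>2 * r\<^sup>2 \<le> max 4 (K\<^sup>2) * r\<^sup>2"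
    by (intro mult_right_mono) auto
  ultimately show ?thesis
    unfolding e_def[symmetric] min_def by (auto simp: power_mult_distrib mult.commute le_max_iff_disj)
qed

text \<open>Subtracting the quotients cancels f(x) and leaves (1 - e^(i theta)) f(y) over the root
  of the kernel's denominator. So square integrability of f suffices: the square is at most a
  constant times |f(y)|^2 times \<open>truncated_kernel\<close>, and the convolution bound
  applies.\<close>

lemma magnetic_quotient_diff_L2:
  fixes A :: "'a::euclidean_space \<Rightarrow> 'a"
  assumes \<Omega>: "open \<Omega>" and s: "0 < s" "s < 1"
    and A: "A \<in> borel_measurable (lebesgue_on (convex hull \<Omega>))" "bounded (A ` (convex hull \<Omega>))"
    and f: "f \<in> L2_fun (lebesgue_on \<Omega>)"
  shows "lincomb 1 (magnetic_quotient s A f) (-1) (magnetic_quotient s (\<lambda>_. 0) f)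
    \<in> L2_fun (lebesgue_on (\<Omega> \<times> \<Omega>))"
    (is "?D \<in> _")
proof -
  have f_meas [measurable]: "f \<in> borel_measurable (lebesgue_on \<Omega>)"
    using f by auto
  obtain K where K: "0 \<le> K" "\<And>x. x \<in> convex hull \<Omega> \<Longrightarrow> norm (A x) \<le> K"
  proof -
    obtain K where "0 < K" "\<forall>x\<in>A ` (convex hull \<Omega>). norm x \<le> K"
      using A(2) by (auto simp: bounded_pos)
    then show thesis
      by (intro that[of K]) auto
  qed
  define C where "C = max 4 (K\<^sup>2)"
  have D_meas: "?D \<in> borel_measurable (lebesgue_on (\<Omega> \<times> \<Omega>))"
    by (intro borel_measurable_add borel_measurable_times borel_measurable_const
        magnetic_quotient_measurable A f_meas)
  have bound: "(cmod (?D (x, y)))\<^sup>2 \<le> C * (cmod (f y))\<^sup>2 * truncated_kernel s (x - y)" if "x \<in> \<Omega>" "y \<in> \<Omega>" for x y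
  proof -
    let ?m = "(x + y) /\<^sub>R 2"
    have "(1/2) *\<^sub>R x + (1/2) *\<^sub>R y \<in> convex hull \<Omega>"
      using that by (intro convexD convex_convex_hull hull_inc) auto
    then have "norm (A ?m) \<le> K"
      by (intro K) (simp add: scaleR_add_right)
    then have "\<bar>(x - y) \<bullet> A ?m\<bar> \<le> norm (x - y) * K"
      using Cauchy_Schwarz_ineq2[of "x - y" "A ?m"] mult_left_mono[of "norm (A ?m)" K "norm (x - y)"] by simp
    then have *: "(cmod (1 - exp (\<i> * of_real ((x - y) \<bullet> A ?m))))\<^sup>2 \<le> C * min 1 ((norm (x - y))\<^sup>2)"
      unfolding C_def using K(1) by (intro cmod_one_minus_exp_sq_le) auto
    have "(p - e * q) / c + - 1 * ((p - q) / c) = (1 - e) * q / c" for p e q c :: complex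
      by (simp add: diff_divide_distrib left_diff_distrib)
    from this[of "f x" "exp (\<i> * of_real ((x - y) \<bullet> A ?m))" "f y" "of_real (norm (x - y) powr ((real DIM('a) + 2 * s) / 2))"]
    have "?D (x, y) = (1 - exp (\<i> * of_real ((x - y) \<bullet> A ?m))) * f y
        / of_real (norm (x - y) powr ((real DIM('a) + 2 * s) / 2))"
      by (simp add: magnetic_quotient_def magnetic_diff_def)
    then have "(cmod (?D (x, y)))\<^sup>2 = (cmod (1 - exp (\<i> * of_real ((x - y) \<bullet> A ?m))))\<^sup>2 * (cmod (f y))\<^sup>2
        / norm (x - y) powr (real DIM('a) + 2 * s)"
      by (simp only: norm_divide norm_mult power_divide power_mult_distrib norm_of_real power2_abs powr_half_square)
    also have "\<dots> \<le> C * min 1 ((norm (x - y))\<^sup>2) * (cmod (f y))\<^sup>2 / norm (x - y) powr (real DIM('a) + 2 * s)"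
      by (intro divide_right_mono mult_right_mono *) auto
    finally show ?thesis
      by (simp add: truncated_kernel_def mult_ac)
  qed
  have "(\<integral>\<^sup>+z. ennreal ((cmod (?D z))\<^sup>2) \<partial>lebesgue_on (\<Omega> \<times> \<Omega>))
      \<le> (\<integral>\<^sup>+(x, y). ennreal (C * (cmod (f y))\<^sup>2) * ennreal (truncated_kernel s (x - y)) \<partial>lebesgue_on (\<Omega> \<times> \<Omega>))"
  proof (rule nn_integral_mono)
    fix z
    assume "z \<in> space (lebesgue_on (\<Omega> \<times> \<Omega>))"
    then obtain x y where z: "z = (x, y)" "x \<in> \<Omega>" "y \<in> \<Omega>"
      by (auto simp: space_restrict_space)
    have "ennreal ((cmod (?D (x, y)))\<^sup>2) \<le> ennreal (C * (cmod (f y))\<^sup>2 * truncated_kernel s (x - y))"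
      by (intro ennreal_leI bound z)
    also have "\<dots> = ennreal (C * (cmod (f y))\<^sup>2) * ennreal (truncated_kernel s (x - y))"
      by (simp add: ennreal_mult C_def truncated_kernel_nonneg)
    finally show "ennreal ((cmod (?D z))\<^sup>2)
        \<le> (case z of (x, y) \<Rightarrow> ennreal (C * (cmod (f y))\<^sup>2) * ennreal (truncated_kernel s (x - y)))"
      by (simp add: z(1))
  qed
  also have "\<dots> \<le> (\<integral>\<^sup>+x. ennreal (C * (cmod (f x))\<^sup>2) \<partial>lebesgue_on \<Omega>) * (\<integral>\<^sup>+z. ennreal (truncated_kernel s (z :: 'a)) \<partial>lborel)"
    by (rule nn_integral_convolution_bound(2)[OF \<Omega>]) measurable
  also have "\<dots> < \<infinity>"
  proof -
    have "(\<integral>\<^sup>+x. ennreal (C * (cmod (f x))\<^sup>2) \<partial>lebesgue_on \<Omega>)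
        = ennreal C * (\<integral>\<^sup>+x. ennreal ((cmod (f x))\<^sup>2) \<partial>lebesgue_on \<Omega>)"
      by (subst nn_integral_cmult[symmetric]) (auto simp: ennreal_mult C_def)
    also have "\<dots> < \<infinity>"
      using L2_fun_iff_nn_integral[OF f_meas] f by (simp add: ennreal_mult_less_top)
    finally show ?thesis
      using nn_integral_truncated_kernel[OF s, where 'a = 'a] by (simp add: ennreal_mult_less_top)
  qed
  finally show ?thesis
    using L2_fun_iff_nn_integral[OF D_meas] by simp
qed

text \<open>The quotients with and without field differ by an L^2 function, so they are in L^2
  together. This makes \<open>frac_sobolev\<close> the maximal domain of the quotient with field
  \<open>A\<close>.\<close>

lemma frac_sobolev_iff_magnetic:
  fixes A :: "'a::euclidean_space \<Rightarrow> 'a"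
  assumes \<Omega>: "open \<Omega>" and s: "0 < s" "s < 1"
    and A: "A \<in> borel_measurable (lebesgue_on (convex hull \<Omega>))" "bounded (A ` (convex hull \<Omega>))"
  shows "f \<in> frac_sobolev s \<Omega> \<longleftrightarrow>
    f \<in> L2_fun (lebesgue_on \<Omega>) \<and> magnetic_quotient s A f \<in> L2_fun (lebesgue_on (\<Omega> \<times> \<Omega>))"
proof (cases "f \<in> L2_fun (lebesgue_on \<Omega>)")
  case True
  let ?R = "magnetic_quotient s (\<lambda>_. 0) f" and ?Q = "magnetic_quotient s A f"
  note D = magnetic_quotient_diff_L2[OF \<Omega> s A True]
  have "?R \<in> borel_measurable (lebesgue_on (\<Omega> \<times> \<Omega>))"
    using True by (intro magnetic_quotient_measurable) auto
  then have "f \<in> frac_sobolev s \<Omega> \<longleftrightarrow> ?R \<in> L2_fun (lebesgue_on (\<Omega> \<times> \<Omega>))"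
    using True by (simp add: frac_sobolev_def magnetic_seminorm_sq_eq L2_fun_iff_nn_integral)
  also have "\<dots> \<longleftrightarrow> ?Q \<in> L2_fun (lebesgue_on (\<Omega> \<times> \<Omega>))"
    using L2_fun_lincomb[OF D, of ?R 1 1] L2_fun_lincomb[OF _ D, of ?Q 1 "-1"] by auto
  finally show ?thesis
    using True by simp
qed (simp add: frac_sobolev_def)

text \<open>For fixed (x, y) the quotient depends continuously on the two values f(x) and f(y),
  which converge at almost every pair along a subsequence; the pointwise limit must then agree with
  k.\<close>

lemma magnetic_quotient_closed:
  fixes A :: "'a::euclidean_space \<Rightarrow> 'a"
  assumes \<Omega>: "open \<Omega>"
    and A: "A \<in> borel_measurable (lebesgue_on (convex hull \<Omega>))"
    and F: "\<And>n. F n \<in> L2_fun (lebesgue_on \<Omega>)" "\<And>n. magnetic_quotient s A (F n) \<in> L2_fun (lebesgue_on (\<Omega> \<times> \<Omega>))"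
    and f: "f \<in> L2_fun (lebesgue_on \<Omega>)"
      "(\<lambda>n. Re (L2_ip (lebesgue_on \<Omega>) (lincomb 1 (F n) (-1) f) (lincomb 1 (F n) (-1) f))) \<longlonglongrightarrow> 0"
    and k: "k \<in> L2_fun (lebesgue_on (\<Omega> \<times> \<Omega>))"
      "(\<lambda>n. Re (L2_ip (lebesgue_on (\<Omega> \<times> \<Omega>)) (lincomb 1 (magnetic_quotient s A (F n)) (-1) k)
        (lincomb 1 (magnetic_quotient s A (F n)) (-1) k))) \<longlonglongrightarrow> 0"
  shows "AE z in lebesgue_on (\<Omega> \<times> \<Omega>). magnetic_quotient s A f z = k z"
proof -
  note \<Omega>L = open_lebesgue_on_sets[OF \<Omega>]
  obtain r where r: "strict_mono r" "AE x in lebesgue_on \<Omega>. (\<lambda>n. F (r n) x) \<longlonglongrightarrow> f x"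
    using L2_AE_subseq[OF F(1) f] by blast
  \<comment> \<open>Extracting from the first subsequence makes all three limits available along the
    second.\<close>
  obtain r' where r': "strict_mono r'"
    "AE z in lebesgue_on (\<Omega> \<times> \<Omega>). (\<lambda>n. magnetic_quotient s A (F (r (r' n))) z) \<longlonglongrightarrow> k z"
    using L2_AE_subseq[OF F(2) k(1) LIMSEQ_subseq_LIMSEQ[OF k(2) r(1), unfolded o_def]] by blast
  have "AE z in lebesgue_on (\<Omega> \<times> \<Omega>). (\<lambda>n. F (r n) (fst z)) \<longlonglongrightarrow> f (fst z)"
    by (rule AE_lebesgue_on_vimage[OF null_sets_fst_vimage \<Omega>L(2,1) _ r(2)]) auto
  moreover have "AE z in lebesgue_on (\<Omega> \<times> \<Omega>). (\<lambda>n. F (r n) (snd z)) \<longlonglongrightarrow> f (snd z)"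
    by (rule AE_lebesgue_on_vimage[OF null_sets_snd_vimage \<Omega>L(2,1) _ r(2)]) auto
  ultimately show ?thesis
    using r'(2)
  proof eventually_elim
    case (elim z)
    have "(\<lambda>n. magnetic_quotient s A (F (r (r' n))) z) \<longlonglongrightarrow> magnetic_quotient s A f z"
      \<comment> \<open>As multiplication by a constant inverse, the division passes to the limit on
        the diagonal too, where the denominator is 0.\<close>
      unfolding magnetic_quotient_def magnetic_diff_def divide_inverse
      using LIMSEQ_subseq_LIMSEQ[OF elim(1) r'(1)] LIMSEQ_subseq_LIMSEQ[OF elim(2) r'(1)]
      by (intro tendsto_intros) (simp_all add: o_def)
    then show ?case
      using elim(3) LIMSEQ_unique by blast
  qed
qed

section \<open>Density of the fractional Sobolev space\<close>

lemma sigma_finite_lebesgue: "sigma_finite_measure (lebesgue :: 'a::euclidean_space measure)"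
proof
  obtain A :: "'a set set" where A: "countable A" "A \<subseteq> sets lborel" "\<Union>A = space lborel"
      "\<forall>a\<in>A. emeasure lborel a \<noteq> \<infinity>"
    using lborel.sigma_finite_countable by blast
  then have "A \<subseteq> sets lebesgue" "\<forall>a\<in>A. emeasure lebesgue a \<noteq> \<infinity>"
    by auto
  then show "\<exists>A :: 'a set set. countable A \<and> A \<subseteq> sets lebesgue \<and> \<Union>A = space lebesgue
      \<and> (\<forall>a\<in>A. emeasure lebesgue a \<noteq> \<infinity>)"
    using A(1,3) by auto
qed

text \<open>Outer regularity: a Lebesgue set is a G-delta up to a null set, and a G-delta is a
  decreasing limit of open sets, along which the integrals converge.\<close>

lemma AE_eq_0_if_integral_open_eq_0:
  fixes h :: "'a::euclidean_space \<Rightarrow> 'b::{banach, second_countable_topology}"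
  assumes h: "integrable lebesgue h" and zero: "\<And>U. open U \<Longrightarrow> (\<integral>x\<in>U. h x \<partial>lebesgue) = 0"
  shows "AE x in lebesgue. h x = 0"
proof (rule sigma_finite_measure.density_zero[OF sigma_finite_lebesgue h])
  fix E :: "'a set"
  assume "E \<in> sets lebesgue"
  from lebesgue_set_almost_gdelta[OF this] obtain C T
    where C: "gdelta C" "T \<in> null_sets lebesgue" "E \<union> T = C" "disjnt E T" .
  obtain W :: "nat \<Rightarrow> 'a set" where W: "\<And>n. open (W n)" "C = (\<Inter>n. W n)"
    using C(1) by (auto simp: gdelta.simps)
  define U where "U n = (\<Inter>i\<le>n. W i)" for n
  have U: "open (U n)" for n
    by (auto simp: U_def W)
  then have UL: "U n \<in> sets lebesgue" for n
    by auto
  have "set_integrable lebesgue (U 0) h"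
    using h UL by (simp add: set_integrable_def integrable_mult_indicator)
  then have "(\<lambda>n. \<integral>x\<in>U n. h x \<partial>lebesgue) \<longlonglongrightarrow> (\<integral>x\<in>(\<Inter>n. U n). h x \<partial>lebesgue)"
    by (intro set_integral_cont_down UL) (auto simp: decseq_def U_def)
  moreover have "(\<Inter>n. U n) = C"
    by (auto simp: U_def W(2))
  ultimately have "(\<integral>x\<in>C. h x \<partial>lebesgue) = 0"
    by (simp add: zero U LIMSEQ_const_iff)
  moreover have "(\<integral>x\<in>E. h x \<partial>lebesgue) = (\<integral>x\<in>C. h x \<partial>lebesgue)"
  proof (rule set_integral_null_delta[OF h])
    have "C \<in> sets lebesgue"
      using \<open>E \<in> sets lebesgue\<close> C(2,3) by (metis null_setsD2 sets.Un)
    then show "C \<in> sets lebesgue" .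
    have "(E - C) \<union> (C - E) = T"
      using C(3,4) by (auto simp: disjnt_def)
    then show "(E - C) \<union> (C - E) \<in> null_sets lebesgue"
      using C(2) by simp
  qed fact
  ultimately show "(\<integral>x\<in>E. h x \<partial>lebesgue) = 0"
    by simp
qed

text \<open>Lipschitz with constant k, zero off \<open>U\<close>, and convergent to the indicator of
  \<open>U\<close> when \<open>U\<close> is open and bounded: these are the test functions for
  density.\<close>

definition cutoff :: "'a::euclidean_space set \<Rightarrow> nat \<Rightarrow> 'a \<Rightarrow> real" where
  "cutoff U k x = min 1 (real k * infdist x (- U))"

lemma cutoff_bounds: "0 \<le> cutoff U k x" "cutoff U k x \<le> 1"
  by (simp_all add: cutoff_def infdist_nonneg)

lemma cutoff_outside: "x \<notin> U \<Longrightarrow> cutoff U k x = 0"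
  by (simp add: cutoff_def)

lemma cutoff_Lipschitz: "\<bar>cutoff U k x - cutoff U k y\<bar> \<le> real k * norm (x - y)"
proof -
  have "\<bar>cutoff U k x - cutoff U k y\<bar> \<le> \<bar>real k * infdist x (- U) - real k * infdist y (- U)\<bar>"
    by (auto simp: cutoff_def min_def)
  also have "\<dots> = real k * \<bar>infdist x (- U) - infdist y (- U)\<bar>"
    by (simp add: right_diff_distrib[symmetric] abs_mult)
  also have "\<dots> \<le> real k * norm (x - y)"
    using infdist_triangle_abs[of x "- U" y] by (intro mult_left_mono) (simp_all add: dist_norm)
  finally show ?thesis .
qed

text \<open>Boundedness of \<open>U\<close> only serves to make \<open>- U\<close> nonempty: \<open>infdist x {} = 0\<close>.\<close>

lemma cutoff_tendsto:
  assumes "open U" "bounded (U :: 'a::euclidean_space set)"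
  shows "(\<lambda>k. cutoff U k x) \<longlonglongrightarrow> indicator U x"
proof (cases "x \<in> U")
  case True
  have "- U \<noteq> {}"
    using assms(2) not_bounded_UNIV[where 'a = 'a] by (metis Compl_empty_eq double_complement)
  then have "0 < infdist x (- U)"
    using True assms(1) by (intro infdist_pos_not_in_closed) auto
  then obtain K where K: "1 < real K * infdist x (- U)"
    using ex_less_of_nat_mult by blast
  have "\<forall>\<^sub>F k in sequentially. cutoff U k x = 1"
  proof (rule eventually_sequentiallyI)
    fix k
    assume "K \<le> k"
    then have "real K * infdist x (- U) \<le> real k * infdist x (- U)"
      by (intro mult_right_mono) (auto simp: infdist_nonneg)
    then show "cutoff U k x = 1"
      using K by (simp add: cutoff_def)
  qed
  then show ?thesis
    using True by (simp add: tendsto_eventually)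
qed (simp add: cutoff_outside)

lemma cutoff_measurable [measurable]: "cutoff U k \<in> borel_measurable borel"
  unfolding cutoff_def[abs_def] by (intro borel_measurable_continuous_onI continuous_intros)

lemma cutoff_L2:
  fixes U :: "'a::euclidean_space set"
  assumes \<Omega>: "open \<Omega>" and U: "open U" "bounded U" "U \<subseteq> \<Omega>"
  shows "(\<lambda>x. of_real (cutoff U k x)) \<in> L2_fun (lebesgue_on \<Omega>)"
    and "indicator U \<in> L2_fun (lebesgue_on \<Omega>)"
proof -
  have meas: "cutoff U k \<in> borel_measurable (lebesgue_on \<Omega>)"
    by (intro measurable_restrict_space1 measurable_completion) simp
  have [simp]: "U \<inter> \<Omega> = U" "\<Omega> \<in> sets lebesgue" "U \<in> sets lebesgue"
    using U \<Omega> by auto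
  have fin: "(\<integral>\<^sup>+x. indicator U x \<partial>lebesgue_on \<Omega>) < \<infinity>"
    using emeasure_bounded_finite[OF U(2)] U by (simp add: nn_integral_indicator sets_restrict_space_iff emeasure_restrict_space)
  have "(\<integral>\<^sup>+x. ennreal ((cmod (of_real (cutoff U k x)))\<^sup>2) \<partial>lebesgue_on \<Omega>) \<le> (\<integral>\<^sup>+x. indicator U x \<partial>lebesgue_on \<Omega>)"
    using cutoff_bounds[of U k] by (intro nn_integral_mono) (auto simp: indicator_def cutoff_outside power_le_one)
  then show "(\<lambda>x. of_real (cutoff U k x)) \<in> L2_fun (lebesgue_on \<Omega>)"
    using fin meas by (subst L2_fun_iff_nn_integral) auto
  have "(\<integral>\<^sup>+x. ennreal ((cmod (indicator U x))\<^sup>2) \<partial>lebesgue_on \<Omega>) \<le> (\<integral>\<^sup>+x. indicator U x \<partial>lebesgue_on \<Omega>)"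
    by (intro nn_integral_mono) (auto simp: indicator_def)
  then show "indicator U \<in> L2_fun (lebesgue_on \<Omega>)"
    using fin by (subst L2_fun_iff_nn_integral) (auto intro!: borel_measurable_indicator simp: sets_restrict_space_iff U)
qed

text \<open>Increments of the cutoff are at most 1 and at most k |x - y|, whence C = max 1 k^2, and
  they vanish unless x or y lies in \<open>U\<close>. The squared quotient is thus dominated by the
  indicators of \<open>U\<close> at x and y times the truncated kernel, and bounded \<open>U\<close>
  have finite measure.\<close>

lemma cutoff_frac_sobolev:
  fixes U :: "'a::euclidean_space set"
  assumes \<Omega>: "open \<Omega>" and s: "0 < s" "s < 1" and U: "open U" "bounded U" "U \<subseteq> \<Omega>"
  shows "(\<lambda>x. of_real (cutoff U k x)) \<in> frac_sobolev s \<Omega>"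
proof -
  let ?g = "\<lambda>x. complex_of_real (cutoff U k x)"
  define C where "C = max 1 ((real k)\<^sup>2)"
  note L2 = cutoff_L2[OF \<Omega> U]
  have ind [measurable]: "(\<lambda>x. (cmod (indicator U x))\<^sup>2) \<in> borel_measurable (lebesgue_on \<Omega>)"
    using L2(2) by measurable
  have fin: "(\<integral>\<^sup>+x. ennreal (C * (cmod (indicator U x))\<^sup>2) \<partial>lebesgue_on \<Omega>)
      * (\<integral>\<^sup>+z. ennreal (truncated_kernel s (z :: 'a)) \<partial>lborel) < \<infinity>"
  proof -
    have "(\<integral>\<^sup>+x. ennreal (C * (cmod (indicator U x))\<^sup>2) \<partial>lebesgue_on \<Omega>)
        = ennreal C * (\<integral>\<^sup>+x. ennreal ((cmod (indicator U x))\<^sup>2) \<partial>lebesgue_on \<Omega>)"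
      by (subst nn_integral_cmult[symmetric]) (auto simp: ennreal_mult C_def)
    also have "\<dots> < \<infinity>"
      using L2_fun_iff_nn_integral[of "indicator U" "lebesgue_on \<Omega>"] L2(2)
      by (simp add: ennreal_mult_less_top L2_fun_measurable)
    finally show ?thesis
      using nn_integral_truncated_kernel[OF s, where 'a = 'a] by (simp add: ennreal_mult_less_top)
  qed
  have bound: "(cmod (magnetic_quotient s (\<lambda>_. 0) ?g (x, y)))\<^sup>2
      \<le> C * (cmod (indicator U x))\<^sup>2 * truncated_kernel s (x - y)
        + C * (cmod (indicator U y))\<^sup>2 * truncated_kernel s (x - y)" for x y
  proof (cases "x \<in> U \<or> y \<in> U")
    case True
    define a where "a = \<bar>cutoff U k x - cutoff U k y\<bar>"
    have "a \<le> 1" "a \<le> real k * norm (x - y)" "0 \<le> a"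
      using cutoff_bounds[of U k x] cutoff_bounds[of U k y] cutoff_Lipschitz[of U k x y] by (auto simp: a_def)
    then have "a\<^sup>2 \<le> 1\<^sup>2" "a\<^sup>2 \<le> (real k * norm (x - y))\<^sup>2"
      by (intro power_mono; linarith)+
    moreover have "(real k)\<^sup>2 * (norm (x - y))\<^sup>2 \<le> C * (norm (x - y))\<^sup>2"
      unfolding C_def by (intro mult_right_mono) auto
    moreover have "1 \<le> C"
      by (simp add: C_def)
    ultimately have *: "a\<^sup>2 \<le> C * min 1 ((norm (x - y))\<^sup>2)"
      by (auto simp: min_def power_mult_distrib)
    have "(cmod (magnetic_quotient s (\<lambda>_. 0) ?g (x, y)))\<^sup>2 = a\<^sup>2 / norm (x - y) powr (real DIM('a) + 2 * s)"
      unfolding cmod_magnetic_quotient_sq a_def magnetic_diff_def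
      by (simp flip: of_real_diff)
    also have "\<dots> \<le> C * min 1 ((norm (x - y))\<^sup>2) / norm (x - y) powr (real DIM('a) + 2 * s)"
      by (intro divide_right_mono *) simp
    also have "\<dots> = C * truncated_kernel s (x - y)"
      by (simp add: truncated_kernel_def)
    also have "\<dots> \<le> C * (cmod (indicator U x))\<^sup>2 * truncated_kernel s (x - y)
        + C * (cmod (indicator U y))\<^sup>2 * truncated_kernel s (x - y)"
      using True \<open>1 \<le> C\<close> truncated_kernel_nonneg[of s "x - y"] by (auto simp: indicator_def)
    finally show ?thesis .
  next
    case False
    then show ?thesis
      by (simp add: magnetic_quotient_def magnetic_diff_def cutoff_outside)
  qed
  have k_meas: "(\<lambda>z::'a. ennreal (truncated_kernel s z)) \<in> borel_measurable borel"
    by measurable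
  have Cind: "(\<lambda>x. C * (cmod (indicator U x))\<^sup>2) \<in> borel_measurable (lebesgue_on \<Omega>)"
    by measurable
  have pair_meas: "(\<lambda>z. ennreal (truncated_kernel s (fst z - snd z))) \<in> borel_measurable (lebesgue_on (\<Omega> \<times> \<Omega>))"
    by (intro measurable_restrict_space1 measurable_completion measurable_compose[OF _ k_meas])
      (auto intro!: borel_measurable_continuous_onI continuous_intros)
  have Cfst: "(\<lambda>z. ennreal (C * (cmod (indicator U (fst z)))\<^sup>2)) \<in> borel_measurable (lebesgue_on (\<Omega> \<times> \<Omega>))"
    and Csnd: "(\<lambda>z. ennreal (C * (cmod (indicator U (snd z)))\<^sup>2)) \<in> borel_measurable (lebesgue_on (\<Omega> \<times> \<Omega>))"
    using measurable_compose[OF measurable_lebesgue_on_fst_snd(1) Cind]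
      measurable_compose[OF measurable_lebesgue_on_fst_snd(2) Cind] by simp_all
  have "magnetic_seminorm_sq s (\<lambda>_. 0) \<Omega> ?g
      \<le> (\<integral>\<^sup>+z. ennreal (C * (cmod (indicator U (fst z)))\<^sup>2) * ennreal (truncated_kernel s (fst z - snd z))
        + ennreal (C * (cmod (indicator U (snd z)))\<^sup>2) * ennreal (truncated_kernel s (fst z - snd z)) \<partial>lebesgue_on (\<Omega> \<times> \<Omega>))"
    unfolding magnetic_seminorm_sq_eq
  proof (rule nn_integral_mono)
    fix z :: "'a \<times> 'a"
    have "ennreal ((cmod (magnetic_quotient s (\<lambda>_. 0) ?g z))\<^sup>2)
        \<le> ennreal (C * (cmod (indicator U (fst z)))\<^sup>2 * truncated_kernel s (fst z - snd z)
          + C * (cmod (indicator U (snd z)))\<^sup>2 * truncated_kernel s (fst z - snd z))"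
      using bound[of "fst z" "snd z"] by (intro ennreal_leI) simp
    also have "\<dots> = ennreal (C * (cmod (indicator U (fst z)))\<^sup>2) * ennreal (truncated_kernel s (fst z - snd z))
        + ennreal (C * (cmod (indicator U (snd z)))\<^sup>2) * ennreal (truncated_kernel s (fst z - snd z))"
      by (simp add: ennreal_mult ennreal_plus C_def truncated_kernel_nonneg)
    finally show "ennreal ((cmod (magnetic_quotient s (\<lambda>_. 0) ?g z))\<^sup>2)
      \<le> ennreal (C * (cmod (indicator U (fst z)))\<^sup>2) * ennreal (truncated_kernel s (fst z - snd z))
        + ennreal (C * (cmod (indicator U (snd z)))\<^sup>2) * ennreal (truncated_kernel s (fst z - snd z))" .
  qed
  also have "\<dots> = (\<integral>\<^sup>+z. ennreal (C * (cmod (indicator U (fst z)))\<^sup>2) * ennreal (truncated_kernel s (fst z - snd z)) \<partial>lebesgue_on (\<Omega> \<times> \<Omega>))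
      + (\<integral>\<^sup>+z. ennreal (C * (cmod (indicator U (snd z)))\<^sup>2) * ennreal (truncated_kernel s (fst z - snd z)) \<partial>lebesgue_on (\<Omega> \<times> \<Omega>))"
    by (intro nn_integral_add borel_measurable_times_ennreal Cfst Csnd pair_meas)
  also have "\<dots> < \<infinity>"
    using le_less_trans[OF nn_integral_convolution_bound(1)[OF \<Omega> Cind k_meas] fin]
      le_less_trans[OF nn_integral_convolution_bound(2)[OF \<Omega> Cind k_meas] fin]
    by (simp add: case_prod_unfold)
  finally show ?thesis
    using L2(1) by (simp add: frac_sobolev_def)
qed

text \<open>Testing with cutoffs and letting k grow, h integrates to 0 over every bounded open
  subset of \<Omega>; open sets determine h almost everywhere.\<close>

lemma frac_sobolev_dense:
  fixes \<Omega> :: "'a::euclidean_space set"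
  assumes \<Omega>: "open \<Omega>" and s: "0 < s" "s < 1" and h: "h \<in> L2_fun (lebesgue_on \<Omega>)"
    and orth: "\<And>g. g \<in> frac_sobolev s \<Omega> \<Longrightarrow> L2_ip (lebesgue_on \<Omega>) h g = 0"
  shows "AE x in lebesgue_on \<Omega>. h x = 0"
proof -
  have \<Omega>L: "\<Omega> \<in> sets lebesgue"
    using \<Omega> by auto
  have h_meas [measurable]: "h \<in> borel_measurable (lebesgue_on \<Omega>)"
    using h by auto
  have local_integrable: "integrable (lebesgue_on \<Omega>) (\<lambda>x. h x * indicator U x)"
    if U: "open U" "bounded U" "U \<subseteq> \<Omega>" for U
  proof -
    have "integrable (lebesgue_on \<Omega>) (\<lambda>x. h x * cnj (indicator U x))"
      by (intro L2_fun_mult_integrable h cutoff_L2(2) \<Omega> U)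
    moreover have "cnj (indicator U x) = indicator U x" for x :: 'a
      by (simp add: indicator_def)
    ultimately show ?thesis
      by simp
  qed
  have zero: "(\<integral>x. h x * indicator U x \<partial>lebesgue_on \<Omega>) = 0" if U: "open U" "bounded U" "U \<subseteq> \<Omega>" for U
  proof -
    have "(\<lambda>k. \<integral>x. h x * cnj (of_real (cutoff U k x)) \<partial>lebesgue_on \<Omega>) \<longlonglongrightarrow> (\<integral>x. h x * indicator U x \<partial>lebesgue_on \<Omega>)"
    proof (rule integral_dominated_convergence)
      show "integrable (lebesgue_on \<Omega>) (\<lambda>x. norm (h x * indicator U x))"
        by (intro integrable_norm local_integrable U)
      show "(\<lambda>x. h x * indicator U x) \<in> borel_measurable (lebesgue_on \<Omega>)"
        using local_integrable[OF U] by auto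
      show "(\<lambda>x. h x * cnj (of_real (cutoff U k x))) \<in> borel_measurable (lebesgue_on \<Omega>)" for k
        using L2_fun_mult_integrable[OF h cutoff_L2(1)[OF \<Omega> U]] by auto
      have "(\<lambda>k. h x * cnj (of_real (cutoff U k x))) \<longlonglongrightarrow> h x * cnj (of_real (indicator U x))" for x
        by (intro tendsto_intros cutoff_tendsto U)
      moreover have "cnj (of_real (indicator U x)) = indicator U x" for x :: 'a
        by (simp add: indicator_def)
      ultimately show "AE x in lebesgue_on \<Omega>. (\<lambda>k. h x * cnj (of_real (cutoff U k x))) \<longlonglongrightarrow> h x * indicator U x"
        by simp
      have "cmod (h x * cnj (of_real (cutoff U k x))) \<le> norm (h x * indicator U x)" for x k
        using cutoff_bounds[of U k x] by (auto simp: norm_mult indicator_def cutoff_outside mult_left_le)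
      then show "AE x in lebesgue_on \<Omega>. norm (h x * cnj (of_real (cutoff U k x))) \<le> norm (h x * indicator U x)" for k
        by simp
    qed
    moreover have "(\<integral>x. h x * cnj (of_real (cutoff U k x)) \<partial>lebesgue_on \<Omega>) = 0" for k
      using orth[OF cutoff_frac_sobolev[OF \<Omega> s U]] by (simp add: L2_ip_def)
    ultimately show ?thesis
      by (simp add: LIMSEQ_const_iff)
  qed
  \<comment> \<open>An L^2 function need not be integrable over a set of infinite measure, so h is
    treated on countably many balls that exhaust the space.\<close>
  have "AE x in lebesgue. x \<in> \<Omega> \<inter> ball 0 (real n) \<longrightarrow> h x = 0" for n
  proof -
    define U where "U = \<Omega> \<inter> ball 0 (real n)"
    have U: "open U" "bounded U" "U \<subseteq> \<Omega>"
      using \<Omega> by (auto simp: U_def)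
    \<comment> \<open>Outside \<Omega> nothing is known about h; the indicator extends it by 0 to a
      function on the whole space.\<close>
    let ?h = "\<lambda>x. indicator \<Omega> x *\<^sub>R (h x * indicator U x)"
    have "AE x in lebesgue. ?h x = 0"
    proof (rule AE_eq_0_if_integral_open_eq_0)
      show "integrable lebesgue ?h"
        using local_integrable[OF U] \<Omega>L by (simp add: integrable_restrict_space)
      fix V :: "'a set"
      assume "open V"
      then have V: "open (U \<inter> V)" "bounded (U \<inter> V)" "U \<inter> V \<subseteq> \<Omega>"
        using U by (auto intro: bounded_subset)
      have "(\<integral>x\<in>V. ?h x \<partial>lebesgue) = (\<integral>x. indicator \<Omega> x *\<^sub>R (h x * indicator (U \<inter> V) x) \<partial>lebesgue)"
        unfolding set_lebesgue_integral_def by (intro Bochner_Integration.integral_cong) (auto simp: indicator_def)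
      also have "\<dots> = (\<integral>x. h x * indicator (U \<inter> V) x \<partial>lebesgue_on \<Omega>)"
        using \<Omega>L by (simp add: integral_restrict_space)
      finally show "(\<integral>x\<in>V. ?h x \<partial>lebesgue) = 0"
        by (simp add: zero[OF V])
    qed
    then show ?thesis
      by eventually_elim (auto simp: U_def indicator_def)
  qed
  then have "AE x in lebesgue. \<forall>n. x \<in> \<Omega> \<inter> ball 0 (real n) \<longrightarrow> h x = 0"
    unfolding AE_all_countable by blast
  then have "AE x in lebesgue. x \<in> \<Omega> \<longrightarrow> h x = 0"
  proof eventually_elim
    case (elim x)
    obtain n where "norm x < real n"
      using reals_Archimedean2 by blast
    then show ?case
      using elim by auto
  qed
  then show ?thesis
    using \<Omega>L by (simp add: AE_restrict_space_iff)
qed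

theorem lemma4p1:
  fixes \<Omega> :: "(real ^ 'n) set" and s :: real and A :: "real ^ 'n \<Rightarrow> real ^ 'n"
  assumes "open \<Omega>" and "connected \<Omega>"
    and "0 < s" and "s < 1"
    and "A \<in> borel_measurable (lebesgue_on (convex hull \<Omega>))"
    and "bounded (A ` (convex hull \<Omega>))"
  shows "L2_self_adjoint (lebesgue_on \<Omega>) (magnetic_frac_laplacian s A \<Omega>)"
proof -
  note V_iff = frac_sobolev_iff_magnetic[OF assms(1,3-6)]
  interpret closed_dense_operator "lebesgue_on \<Omega>" "lebesgue_on (\<Omega> \<times> \<Omega>)" "frac_sobolev s \<Omega>" "magnetic_quotient s A"
  proof
    show "f \<in> L2_fun (lebesgue_on \<Omega>)" "magnetic_quotient s A f \<in> L2_fun (lebesgue_on (\<Omega> \<times> \<Omega>))"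
      if "f \<in> frac_sobolev s \<Omega>" for f
      using that V_iff by blast+
    have "(\<lambda>_. 0) \<in> frac_sobolev s \<Omega>"
      by (simp add: frac_sobolev_def L2_fun_def magnetic_seminorm_sq_def magnetic_diff_def case_prod_unfold)
    then show "frac_sobolev s \<Omega> \<noteq> {}"
      by blast
    show "lincomb c f d g \<in> frac_sobolev s \<Omega>" if "f \<in> frac_sobolev s \<Omega>" "g \<in> frac_sobolev s \<Omega>" for f g c d
      using that unfolding V_iff magnetic_quotient_lincomb by (blast intro: L2_fun_lincomb)
    show "magnetic_quotient s A (lincomb c f d g) = lincomb c (magnetic_quotient s A f) d (magnetic_quotient s A g)" for f g c d
      by (rule magnetic_quotient_lincomb)
    show "AE x in lebesgue_on \<Omega>. h x = 0"
      if "h \<in> L2_fun (lebesgue_on \<Omega>)" "\<And>g. g \<in> frac_sobolev s \<Omega> \<Longrightarrow> L2_ip (lebesgue_on \<Omega>) h g = 0" for h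
      using frac_sobolev_dense[OF assms(1,3,4) that] .
    fix F :: "nat \<Rightarrow> real ^ 'n \<Rightarrow> complex" and f k
    assume F: "\<And>n. F n \<in> frac_sobolev s \<Omega>" and f: "f \<in> L2_fun (lebesgue_on \<Omega>)"
      and k: "k \<in> L2_fun (lebesgue_on (\<Omega> \<times> \<Omega>))"
      and lim: "(\<lambda>n. Re (L2_ip (lebesgue_on \<Omega>) (lincomb 1 (F n) (-1) f) (lincomb 1 (F n) (-1) f))) \<longlonglongrightarrow> 0"
        "(\<lambda>n. Re (L2_ip (lebesgue_on (\<Omega> \<times> \<Omega>)) (lincomb 1 (magnetic_quotient s A (F n)) (-1) k)
          (lincomb 1 (magnetic_quotient s A (F n)) (-1) k))) \<longlonglongrightarrow> 0"
    have FL2: "F n \<in> L2_fun (lebesgue_on \<Omega>)" "magnetic_quotient s A (F n) \<in> L2_fun (lebesgue_on (\<Omega> \<times> \<Omega>))" for n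
      using F V_iff by blast+
    have ae: "AE z in lebesgue_on (\<Omega> \<times> \<Omega>). magnetic_quotient s A f z = k z"
      by (rule magnetic_quotient_closed[OF assms(1,5) FL2 f lim(1) k lim(2)])
    \<comment> \<open>Closedness also asks for f in the domain: its quotient is measurable and
      agrees almost everywhere with k, so it is in L^2, and \<open>V_iff\<close> applies.\<close>
    moreover have "magnetic_quotient s A f \<in> L2_fun (lebesgue_on (\<Omega> \<times> \<Omega>))"
      using f by (intro L2_fun_cong_AE[OF k _ ae] magnetic_quotient_measurable[OF assms(5)]) auto
    ultimately show "f \<in> frac_sobolev s \<Omega> \<and> (AE z in lebesgue_on (\<Omega> \<times> \<Omega>). magnetic_quotient s A f z = k z)"
      using f V_iff by blast
  qed
  have "magnetic_frac_laplacian s A \<Omega> = graph"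
    unfolding magnetic_frac_laplacian_def graph_def weak_solution_def magnetic_form_eq_ip L2_ip_def ..
  then show ?thesis
    using L2_self_adjoint_graph by simp
qed

end
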